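(* Let $q$ be an odd prime and let $s$ be an integer with $2\le s<q$. Define $$r:=\frac{q^{s+1}-1}{q-1}$$ and assume $r+1=2p$, where $p$ is an odd prime. Then there exists a group $\mathcal{G}$ with a non-normal, nonabelian Sylow $q$-subgroup containing a difference set with McFarland parameters $$v=q^{s+1}\left(\frac{q^{s+1}-1}{q-1}+1\right),\qquad k=q^s\left(\frac{q^{s+1}-1}{q-1}\right),\qquad \lambda=q^s\left(\frac{q^s-1}{q-1}\right).$$
   Context: A subset $D$ of a finite group $G$ is a $(v,k,\lambda)$-difference set if $|G|=v$, $|D|=k$, and every $g\in G\setminus\{1\}$ can be expressed in exactly $\lambda$ ways as $d_1d_2^{-1}$ with $d_1,d_2\in D$. *)

theory Defs
  imports "HOL-Algebra.Algebra"
begin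

definition sylow_subgroup :: "nat \<Rightarrow> ('a, 'b) monoid_scheme \<Rightarrow> 'a set \<Rightarrow> bool" where
  "sylow_subgroup p G H \<longleftrightarrow>
     Factorial_Ring.prime p \<and> group G \<and> finite (carrier G) \<and>
     subgroup H G \<and> card H = p ^ multiplicity p (order G)"

definition difference_set ::
    "('a, 'b) monoid_scheme \<Rightarrow> 'a set \<Rightarrow> nat \<Rightarrow> nat \<Rightarrow> nat \<Rightarrow> bool" where
  "difference_set G D v k l \<longleftrightarrow>
     group G \<and> finite (carrier G) \<and> D \<subseteq> carrier G \<and> order G = v \<and> card D = k \<and>
     (\<forall>g \<in> carrier G - {\<one>\<^bsub>G\<^esub>}.
        card {(d1, d2). d1 \<in> D \<and> d2 \<in> D \<and> d1 \<otimes>\<^bsub>G\<^esub> inv\<^bsub>G\<^esub> d2 = g} = l)"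

end

theory Submission
  imports Defs "HOL-Number_Theory.Pocklington"
begin

text \<open>Let \<open>E\<close> be the elementary abelian group of order \<open>q ^ (s + 1)\<close> and \<open>K\<close> the cyclic group of order
\<open>2 * p = r + 1\<close>. McFarland's construction labels the \<open>r\<close> hyperplanes of \<open>E\<close> by the nonzero elements
of \<open>K\<close>, in any bijective way, and takes the pairs \<open>(u, k)\<close> with \<open>u\<close> in the hyperplane labelled \<open>k\<close>;
this is a difference set in \<open>E \<times> K\<close> with the required parameters
(\<open>difference_set_DirProd_subgroups\<close>). The Sylow subgroup \<open>E\<close> is abelian and normal there, so the group
has to be changed while the set is kept.

Let \<open>\<theta>\<close> be an automorphism of a group \<open>A\<close> with \<open>\<theta> D = D\<close> for a difference set \<open>D\<close>. Suppose that
\<open>c\<close> assigns exponents to the elements of \<open>A\<close> so that \<open>a \<circ> b = a \<cdot> \<theta>^(c a) b\<close> is again a group operation.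
Then \<open>D\<close> is still a difference set, with the same parameters: the number of \<open>d \<in> D\<close> with
\<open>g \<circ> d \<in> D\<close> is the number of \<open>d \<in> D\<close> with \<open>g \<cdot> \<theta>^(c g) d \<in> D\<close>, and \<open>\<theta>^(c g)\<close> permutes \<open>D\<close>
(\<open>difference_set_twisted\<close>). Geometrically, the new group is another regular group of automorphisms of
the same symmetric design.

It remains to choose the labelling so that \<open>D\<close> has a good automorphism of order \<open>q\<close>. A unipotent
Jordan block of size \<open>s + 1\<close> has order \<open>q\<close> because \<open>s + 1 \<le> q\<close>, and it fixes exactly one hyperplane.
Since \<open>2 * (p - 1) = r - 1\<close> is divisible by \<open>q\<close>, some odd \<open>a\<close> has order \<open>q\<close> modulo \<open>p\<close>, and multiplication
by \<open>a\<close> fixes exactly one nonzero element of \<open>K\<close>, namely \<open>p\<close>. Two permutations of prime order \<open>q\<close> of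
sets of equal size with equally many fixed points are conjugate (\<open>equivariant_bij\<close>), so there is a
labelling that intertwines the two actions; the Jordan block on \<open>E\<close> and multiplication by \<open>a\<close> on \<open>K\<close>
then give the automorphism \<open>\<theta>\<close>. As exponent of \<open>(u, k)\<close> serves the coordinate of \<open>u\<close> that the Jordan block
preserves.

In the twisted group \<open>E \<times> {0}\<close> is a Sylow \<open>q\<close>-subgroup. It is not abelian because the Jordan block acts
nontrivially on the vectors of exponent \<open>0\<close> (here \<open>2 \<le> s\<close> enters), and it is not normal because its
elements of exponent \<open>1\<close> act on \<open>K\<close> as multiplication by \<open>a\<close>.\<close>

section \<open>Difference sets counted by left translates\<close>

lemma (in group) quotient_pairs_eq:
  assumes "D \<subseteq> carrier G" "g \<in> carrier G"
  shows "card {(d1, d2). d1 \<in> D \<and> d2 \<in> D \<and> d1 \<otimes> inv d2 = g} = card {d \<in> D. g \<otimes> d \<in> D}"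
proof -
  have "{(d1, d2). d1 \<in> D \<and> d2 \<in> D \<and> d1 \<otimes> inv d2 = g} = (\<lambda>d. (g \<otimes> d, d)) ` {d \<in> D. g \<otimes> d \<in> D}"
    using assms by (auto simp: m_assoc subset_iff image_iff)
  then show ?thesis by (simp add: card_image inj_on_def)
qed

text \<open>Writing \<open>d1 = g \<cdot> d2\<close> turns quotients into left translates, so that inverses disappear from all later
counts.\<close>
lemma difference_set_iff:
  "difference_set G D v k l \<longleftrightarrow>
     group G \<and> finite (carrier G) \<and> D \<subseteq> carrier G \<and> order G = v \<and> card D = k \<and>
     (\<forall>g \<in> carrier G - {\<one>\<^bsub>G\<^esub>}. card {d \<in> D. g \<otimes>\<^bsub>G\<^esub> d \<in> D} = l)"
  unfolding difference_set_def
  by (auto simp: group.quotient_pairs_eq)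

section \<open>Twisting a group by a gamma function\<close>

definition twisted_group :: "('a, 'b) monoid_scheme \<Rightarrow> ('a \<Rightarrow> 'a \<Rightarrow> 'a) \<Rightarrow> 'a monoid" where
  "twisted_group G \<phi> =
     \<lparr>carrier = carrier G, monoid.mult = (\<lambda>a b. a \<otimes>\<^bsub>G\<^esub> \<phi> a b), one = \<one>\<^bsub>G\<^esub>\<rparr>"

text \<open>The equation below is exactly associativity of \<open>a \<circ> b = a \<cdot> \<phi> a b\<close>; it says that \<open>\<phi>\<close> is a homomorphism
from the twisted group to the automorphism group. Such maps are the gamma functions of skew brace theory.\<close>
locale gamma_function = group G for G (structure) +
  fixes \<phi> :: "'a \<Rightarrow> 'a \<Rightarrow> 'a"
  assumes iso: "a \<in> carrier G \<Longrightarrow> \<phi> a \<in> iso G G"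
    and functional_equation:
      "\<lbrakk>a \<in> carrier G; b \<in> carrier G; c \<in> carrier G\<rbrakk> \<Longrightarrow> \<phi> (a \<otimes> \<phi> a b) c = \<phi> a (\<phi> b c)"
begin

lemma closed: "\<lbrakk>a \<in> carrier G; b \<in> carrier G\<rbrakk> \<Longrightarrow> \<phi> a b \<in> carrier G"
  using iso[of a] by (auto simp: iso_def hom_def)

lemma mult: "\<lbrakk>a \<in> carrier G; b \<in> carrier G; c \<in> carrier G\<rbrakk> \<Longrightarrow> \<phi> a (b \<otimes> c) = \<phi> a b \<otimes> \<phi> a c"
  using iso[of a] by (auto simp: iso_def hom_def)

lemma bij: "a \<in> carrier G \<Longrightarrow> bij_betw (\<phi> a) (carrier G) (carrier G)"
  using iso[of a] by (auto simp: iso_def)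

lemma inj: "\<lbrakk>a \<in> carrier G; b \<in> carrier G; c \<in> carrier G; \<phi> a b = \<phi> a c\<rbrakk> \<Longrightarrow> b = c"
  using bij[of a] by (auto simp: bij_betw_def inj_on_def)

lemma one: "a \<in> carrier G \<Longrightarrow> \<phi> a \<one> = \<one>"
  using mult[of a \<one> \<one>] closed[of a \<one>] by simp

lemma at_one: "c \<in> carrier G \<Longrightarrow> \<phi> \<one> c = c"
  using functional_equation[of \<one> \<one> c] one[of \<one>] closed[of \<one> c] inj[of \<one> "\<phi> \<one> c" c] by simp

text \<open>A left inverse of \<open>a\<close> is the preimage of its old inverse under \<open>\<phi> a\<close>: this is a right inverse \<open>b\<close>, hence
\<open>\<phi> a\<close> and \<open>\<phi> b\<close> cancel, and applying \<open>\<phi> a\<close> shows that \<open>b\<close> is a left inverse as well.\<close>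
lemma group_twisted: "group (twisted_group G \<phi>)"
proof (rule groupI)
  fix a assume "a \<in> carrier (twisted_group G \<phi>)"
  then have a: "a \<in> carrier G" by (simp add: twisted_group_def)
  obtain b where b: "b \<in> carrier G" "\<phi> a b = inv a"
    using bij[OF a] a by (metis bij_betw_iff_bijections inv_closed)
  have "a \<otimes> \<phi> a b = \<one>" using a b by simp
  then have "\<phi> a (\<phi> b a) = a"
    using functional_equation[of a b a] a b at_one by simp
  then have "\<phi> a (b \<otimes> \<phi> b a) = \<phi> a \<one>"
    using a b by (simp add: mult closed one)
  then have "b \<otimes> \<phi> b a = \<one>"
    using a b by (metis closed inj m_closed one_closed)
  then show "\<exists>y\<in>carrier (twisted_group G \<phi>). y \<otimes>\<^bsub>twisted_group G \<phi>\<^esub> a = \<one>\<^bsub>twisted_group G \<phi>\<^esub>"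
    using b by (auto simp: twisted_group_def)
next
  fix a b c assume "a \<in> carrier (twisted_group G \<phi>)" "b \<in> carrier (twisted_group G \<phi>)"
    "c \<in> carrier (twisted_group G \<phi>)"
  then have abc: "a \<in> carrier G" "b \<in> carrier G" "c \<in> carrier G" by (simp_all add: twisted_group_def)
  have "(a \<otimes> \<phi> a b) \<otimes> \<phi> (a \<otimes> \<phi> a b) c = a \<otimes> \<phi> a (b \<otimes> \<phi> b c)"
    using abc by (simp only: functional_equation mult closed m_assoc)
  then show "a \<otimes>\<^bsub>twisted_group G \<phi>\<^esub> b \<otimes>\<^bsub>twisted_group G \<phi>\<^esub> c =
      a \<otimes>\<^bsub>twisted_group G \<phi>\<^esub> (b \<otimes>\<^bsub>twisted_group G \<phi>\<^esub> c)"
    by (simp add: twisted_group_def)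
qed (simp_all add: twisted_group_def closed at_one)

end

text \<open>The old and the new left translation by \<open>g\<close> differ by \<open>\<phi> g\<close>, which merely permutes \<open>D\<close>.\<close>
lemma (in gamma_function) difference_set_twisted:
  assumes D: "difference_set G D v k l" and inv: "\<And>a. a \<in> carrier G \<Longrightarrow> \<phi> a ` D = D"
  shows "difference_set (twisted_group G \<phi>) D v k l"
proof -
  have sub: "D \<subseteq> carrier G" using D by (simp add: difference_set_iff)
  have "card {d \<in> D. g \<otimes> \<phi> g d \<in> D} = l" if g: "g \<in> carrier G" "g \<noteq> \<one>" for g
  proof -
    have "bij_betw (\<phi> g) {d \<in> D. g \<otimes> \<phi> g d \<in> D} {d \<in> D. g \<otimes> d \<in> D}"
      unfolding bij_betw_def
    proof
      show "inj_on (\<phi> g) {d \<in> D. g \<otimes> \<phi> g d \<in> D}"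
        using bij[OF g(1)] sub by (auto simp: bij_betw_def intro: inj_on_subset)
      show "\<phi> g ` {d \<in> D. g \<otimes> \<phi> g d \<in> D} = {d \<in> D. g \<otimes> d \<in> D}"
      proof -
        have "\<phi> g d \<in> D" if "d \<in> D" for d using inv[OF g(1)] that by blast
        moreover have "\<exists>e\<in>D. d = \<phi> g e" if "d \<in> D" for d using inv[OF g(1)] that by (auto elim: equalityE)
        ultimately show ?thesis by auto
      qed
    qed
    then have "card {d \<in> D. g \<otimes> \<phi> g d \<in> D} = card {d \<in> D. g \<otimes> d \<in> D}"
      by (rule bij_betw_same_card)
    then show ?thesis using D g by (simp add: difference_set_iff)
  qed
  then show ?thesis
    using D group_twisted by (auto simp add: difference_set_iff twisted_group_def order_def)
qed

text \<open>The cyclic case: when all \<open>\<phi> a\<close> are powers of one automorphism of period \<open>q\<close>, only the exponents have to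
add up, and only modulo \<open>q\<close>.\<close>
lemma (in group) gamma_function_funpow:
  assumes iso: "\<theta> \<in> iso G G" and period: "\<And>z. z \<in> carrier G \<Longrightarrow> (\<theta> ^^ q) z = z"
    and additive: "\<And>a b. \<lbrakk>a \<in> carrier G; b \<in> carrier G\<rbrakk> \<Longrightarrow>
      [c (a \<otimes> (\<theta> ^^ c a) b) = c a + c b] (mod q)"
  shows "gamma_function G (\<lambda>a. \<theta> ^^ c a)"
proof
  have "\<theta> ^^ n \<in> iso G G" for n
  proof (induction n)
    case 0
    then show ?case using iso_set_refl by (simp add: id_def)
  next
    case (Suc n)
    then show ?case unfolding funpow.simps by (rule iso_set_trans[OF _ iso])
  qed
  then show "\<theta> ^^ c a \<in> iso G G" for a .
next
  fix a b z assume a: "a \<in> carrier G" and b: "b \<in> carrier G" and z: "z \<in> carrier G"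
  have "(\<theta> ^^ c (a \<otimes> (\<theta> ^^ c a) b)) z = (\<theta> ^^ (c a + c b)) z"
    using additive[OF a b] funpow_mod_eq[OF period[OF z]] unfolding cong_def by metis
  then show "(\<theta> ^^ c (a \<otimes> (\<theta> ^^ c a) b)) z = (\<theta> ^^ c a) ((\<theta> ^^ c b) z)"
    by (simp add: funpow_add)
qed

section \<open>McFarland's construction from subgroups\<close>

lemma card_fiber_surj_hom:
  assumes "group G" "group H" "f \<in> hom G H" "f ` carrier G = carrier H" "finite (carrier G)" "y \<in> carrier H"
  shows "card {x \<in> carrier G. f x = y} * card (carrier H) = card (carrier G)"
proof -
  interpret group_hom G H f by (intro group_hom.intro group_hom_axioms.intro assms)
  have fib: "card {x \<in> carrier G. f x = z} = card (kernel G H f)" if z: "z \<in> carrier H" for z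
  proof -
    obtain a where a: "a \<in> carrier G" "f a = z" using z unfolding assms(4)[symmetric] by blast
    have "bij_betw (\<lambda>x. a \<otimes>\<^bsub>G\<^esub> x) (kernel G H f) {x \<in> carrier G. f x = z}"
    proof (rule bij_betw_byWitness[where f' = "\<lambda>x. inv\<^bsub>G\<^esub> a \<otimes>\<^bsub>G\<^esub> x"])
      show "\<forall>x\<in>kernel G H f. inv\<^bsub>G\<^esub> a \<otimes>\<^bsub>G\<^esub> (a \<otimes>\<^bsub>G\<^esub> x) = x" "\<forall>x\<in>{x \<in> carrier G. f x = z}. a \<otimes>\<^bsub>G\<^esub> (inv\<^bsub>G\<^esub> a \<otimes>\<^bsub>G\<^esub> x) = x"
        using a(1) by (simp_all add: kernel_def flip: G.m_assoc)
      show "(\<lambda>x. a \<otimes>\<^bsub>G\<^esub> x) ` kernel G H f \<subseteq> {x \<in> carrier G. f x = z}"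
        using a z by (auto simp: kernel_def)
      show "(\<lambda>x. inv\<^bsub>G\<^esub> a \<otimes>\<^bsub>G\<^esub> x) ` {x \<in> carrier G. f x = z} \<subseteq> kernel G H f"
        using a by (auto simp: kernel_def)
    qed
    then show ?thesis by (rule bij_betw_same_card[symmetric])
  qed
  have fH: "finite (carrier H)" using finite_imageI[OF assms(5), of f] assms(4) by simp
  have "card (carrier G) = (\<Sum>z\<in>carrier H. card {x \<in> carrier G. f x = z})"
  proof -
    have "carrier G = (\<Union>z\<in>carrier H. {x \<in> carrier G. f x = z})" using assms(4) by auto
    moreover have "card (\<Union>z\<in>carrier H. {x \<in> carrier G. f x = z}) = (\<Sum>z\<in>carrier H. card {x \<in> carrier G. f x = z})"
      by (rule card_UN_disjoint[OF fH]) (use assms(5) in auto)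
    ultimately show ?thesis by argo
  qed
  then show ?thesis using fib assms(6) by simp
qed

text \<open>For \<open>(g, c)\<close> with \<open>c \<noteq> 1\<close>, the translate moves the slice over \<open>k\<close> to the slice over the different element
\<open>c \<cdot> k\<close>, and each of the \<open>|K| - 2\<close> admissible \<open>k\<close> contributes one intersection of a subgroup with a coset
of another. For \<open>c = 1\<close> every slice stays in place and is either fixed by \<open>g\<close> or moved off itself, which
counts the subgroups containing \<open>g\<close>. The last two hypotheses say that the two counts agree.\<close>
lemma difference_set_DirProd_subgroups:
  fixes E :: "('a, 'b) monoid_scheme" and K :: "('c, 'd) monoid_scheme" and H :: "'c \<Rightarrow> 'a set"
  assumes E: "group E" "finite (carrier E)" and K: "group K" "finite (carrier K)"
    and H: "\<And>k. k \<in> carrier K - {\<one>\<^bsub>K\<^esub>} \<Longrightarrow> subgroup (H k) E"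
    and h: "\<And>k. k \<in> carrier K - {\<one>\<^bsub>K\<^esub>} \<Longrightarrow> card (H k) = h"
    and meet: "\<And>k k' g. \<lbrakk>k \<in> carrier K - {\<one>\<^bsub>K\<^esub>}; k' \<in> carrier K - {\<one>\<^bsub>K\<^esub>}; k \<noteq> k'; g \<in> carrier E\<rbrakk>
               \<Longrightarrow> card {u \<in> H k. g \<otimes>\<^bsub>E\<^esub> u \<in> H k'} = m"
    and cover: "\<And>g. g \<in> carrier E - {\<one>\<^bsub>E\<^esub>} \<Longrightarrow> card {k \<in> carrier K - {\<one>\<^bsub>K\<^esub>}. g \<in> H k} = n"
    and l: "n * h = l" "(order K - 2) * m = l"
  shows "difference_set (E \<times>\<times> K) {(u, k). k \<in> carrier K - {\<one>\<^bsub>K\<^esub>} \<and> u \<in> H k}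
           (order E * order K) ((order K - 1) * h) l"
proof -
  interpret E: group E by fact
  interpret K: group K by fact
  let ?K = "carrier K - {\<one>\<^bsub>K\<^esub>}"
  let ?D = "{(u, k). k \<in> ?K \<and> u \<in> H k}"
  have HE: "H k \<subseteq> carrier E" if "k \<in> ?K" for k using H[OF that] by (rule subgroup.subset)
  have fH: "finite (H k)" if "k \<in> ?K" for k using HE[OF that] E(2) by (rule finite_subset)
  have slices: "card {(u, k). k \<in> ?K \<and> u \<in> H k \<and> P u k} = (\<Sum>k\<in>?K. card {u \<in> H k. P u k})" for P
  proof -
    have "{(u, k). k \<in> ?K \<and> u \<in> H k \<and> P u k} = prod.swap ` (SIGMA k:?K. {u \<in> H k. P u k})"
      by auto
    moreover have "card (prod.swap ` (SIGMA k:?K. {u \<in> H k. P u k})) = card (SIGMA k:?K. {u \<in> H k. P u k})"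
      by (rule card_image) (simp add: inj_on_def)
    ultimately show ?thesis using K(2) fH by (simp add: card_SigmaI)
  qed
  have cK: "card ?K = order K - 1" using K(2) by (simp add: order_def)
  have "card ?D = (order K - 1) * h"
    using slices[of "\<lambda>_ _. True"] h cK by simp
  moreover have "card {d \<in> ?D. g \<otimes>\<^bsub>E \<times>\<times> K\<^esub> d \<in> ?D} = l"
    if g: "g \<in> carrier (E \<times>\<times> K) - {\<one>\<^bsub>E \<times>\<times> K\<^esub>}" for g
  proof -
    obtain a c where gac: "g = (a, c)" and a: "a \<in> carrier E" and c: "c \<in> carrier K"
      using g by auto
    have "{d \<in> ?D. g \<otimes>\<^bsub>E \<times>\<times> K\<^esub> d \<in> ?D} =
       {(u, k). k \<in> ?K \<and> u \<in> H k \<and> (c \<otimes>\<^bsub>K\<^esub> k \<in> ?K \<and> a \<otimes>\<^bsub>E\<^esub> u \<in> H (c \<otimes>\<^bsub>K\<^esub> k))}"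
      by (auto simp: gac)
    then have count: "card {d \<in> ?D. g \<otimes>\<^bsub>E \<times>\<times> K\<^esub> d \<in> ?D} =
       (\<Sum>k\<in>?K. card {u \<in> H k. c \<otimes>\<^bsub>K\<^esub> k \<in> ?K \<and> a \<otimes>\<^bsub>E\<^esub> u \<in> H (c \<otimes>\<^bsub>K\<^esub> k)})"
      using slices by simp
    show ?thesis
    proof (cases "c = \<one>\<^bsub>K\<^esub>")
      case True
      then have a1: "a \<in> carrier E - {\<one>\<^bsub>E\<^esub>}" using g gac by auto
      have slice: "card {u \<in> H k. c \<otimes>\<^bsub>K\<^esub> k \<in> ?K \<and> a \<otimes>\<^bsub>E\<^esub> u \<in> H (c \<otimes>\<^bsub>K\<^esub> k)} = (if a \<in> H k then h else 0)"
        if k: "k \<in> ?K" for k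
      proof -
        have "a \<otimes>\<^bsub>E\<^esub> u \<in> H k \<longleftrightarrow> a \<in> H k" if u: "u \<in> H k" for u
        proof
          assume "a \<otimes>\<^bsub>E\<^esub> u \<in> H k"
          then have "a \<otimes>\<^bsub>E\<^esub> u \<otimes>\<^bsub>E\<^esub> inv\<^bsub>E\<^esub> u \<in> H k"
            using H[OF k] u by (simp add: subgroup.m_closed subgroup.m_inv_closed)
          then show "a \<in> H k" using u a HE[OF k] by (simp add: E.m_assoc subset_iff)
        qed (use H[OF k] u in \<open>simp add: subgroup.m_closed\<close>)
        then have "{u \<in> H k. c \<otimes>\<^bsub>K\<^esub> k \<in> ?K \<and> a \<otimes>\<^bsub>E\<^esub> u \<in> H (c \<otimes>\<^bsub>K\<^esub> k)} = (if a \<in> H k then H k else {})"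
          using k True by auto
        then show ?thesis using h k by simp
      qed
      have "card {d \<in> ?D. g \<otimes>\<^bsub>E \<times>\<times> K\<^esub> d \<in> ?D} = (\<Sum>k\<in>?K. if a \<in> H k then h else 0)"
        unfolding count by (rule sum.cong[OF refl], rule slice)
      also have "\<dots> = card {k \<in> ?K. a \<in> H k} * h"
        using K(2) by (simp flip: sum.inter_filter)
      finally show ?thesis using cover[OF a1] l by simp
    next
      case False
      have slice: "card {u \<in> H k. c \<otimes>\<^bsub>K\<^esub> k \<in> ?K \<and> a \<otimes>\<^bsub>E\<^esub> u \<in> H (c \<otimes>\<^bsub>K\<^esub> k)} = (if k = inv\<^bsub>K\<^esub> c then 0 else m)"
        if k: "k \<in> ?K" for k
      proof (cases "k = inv\<^bsub>K\<^esub> c")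
        case True
        then show ?thesis using c by simp
      next
        case ne: False
        have ck: "c \<otimes>\<^bsub>K\<^esub> k \<in> ?K" using ne c k
          by (metis Diff_iff K.inv_equality K.inv_inv K.m_closed singletonD)
        have "c \<otimes>\<^bsub>K\<^esub> k \<noteq> k" using False c k by simp
        then show ?thesis using meet[of k "c \<otimes>\<^bsub>K\<^esub> k" a] k ck a ne by auto
      qed
      have "card {d \<in> ?D. g \<otimes>\<^bsub>E \<times>\<times> K\<^esub> d \<in> ?D} = (\<Sum>k\<in>?K. if k = inv\<^bsub>K\<^esub> c then 0 else m)"
        unfolding count by (rule sum.cong[OF refl], rule slice)
      also have "\<dots> = card (?K - {inv\<^bsub>K\<^esub> c}) * m"
      proof -
        have "(\<Sum>k\<in>?K. if k = inv\<^bsub>K\<^esub> c then 0 else m) = (\<Sum>k\<in>?K - {inv\<^bsub>K\<^esub> c}. m)"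
          by (rule sum.mono_neutral_cong_right) (use K(2) in auto)
        then show ?thesis by simp
      qed
      also have "card (?K - {inv\<^bsub>K\<^esub> c}) = order K - 2"
        using cK False c K(2) by (subst card_Diff_singleton) auto
      finally show ?thesis using l by simp
    qed
  qed
  ultimately show ?thesis
    using E K HE DirProd_group[OF E(1) K(1)]
    unfolding difference_set_iff by (auto simp: order_def card_cartesian_product)
qed

section \<open>Permutations of prime order\<close>

lemma funpow_closed: "f ` A \<subseteq> A \<Longrightarrow> z \<in> A \<Longrightarrow> (f ^^ n) z \<in> A"
  by (induction n) auto

lemma funpow_coprime_fixed:
  assumes "(f ^^ d) z = z" "(f ^^ q) z = z" "coprime d q" "d > 0"
  shows "f z = z"
proof -
  have pow: "(f ^^ (n * e)) z = z" if "(f ^^ e) z = z" for n e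
    using that by (induction n) (simp_all add: funpow_add)
  obtain m n where "m * d = Suc (n * q)"
    using bezout_nat[of d q] assms(3,4) by (auto simp: mult.commute)
  then have "(f ^^ (m * d)) z = (f ^^ (Suc (n * q))) z" by simp
  also have "\<dots> = f z" using pow[OF assms(2), of n] by simp
  finally show ?thesis using pow[OF assms(1), of m] by simp
qed


text \<open>All orbits have size \<open>q\<close>, so one orbit on each side can be matched point by point and removed.\<close>
lemma equivariant_bij_fixpoint_free:
  assumes "Factorial_Ring.prime q" "finite A" "finite B" "card A = card B"
    and "f ` A \<subseteq> A" "\<And>z. z \<in> A \<Longrightarrow> (f ^^ q) z = z" "\<And>z. z \<in> A \<Longrightarrow> f z \<noteq> z"
    and "g ` B \<subseteq> B" "\<And>z. z \<in> B \<Longrightarrow> (g ^^ q) z = z" "\<And>z. z \<in> B \<Longrightarrow> g z \<noteq> z"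
  shows "\<exists>h. bij_betw h A B \<and> (\<forall>z\<in>A. h (f z) = g (h z))"
  using assms(2-)
proof (induction "card A" arbitrary: A B rule: less_induct)
  case less
  have q: "q > 0" using assms(1) by (simp add: prime_gt_0_nat)
  show ?case
  proof (cases "A = {}")
    case True
    then have "B = {}" using less.prems by simp
    then show ?thesis using True by (simp add: bij_betw_def)
  next
    case False
    then obtain a b where a: "a \<in> A" and b: "b \<in> B" using less.prems(1-3) by fastforce
    have orbit_inj: "inj_on (\<lambda>i. (\<sigma> ^^ i) z) {..<q}"
      if "\<sigma> ` Z \<subseteq> Z" "\<And>z. z \<in> Z \<Longrightarrow> (\<sigma> ^^ q) z = z" "\<And>z. z \<in> Z \<Longrightarrow> \<sigma> z \<noteq> z" "z \<in> Z"
      for \<sigma> :: "'c \<Rightarrow> 'c" and Z z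
    proof (rule linorder_inj_onI)
      fix i j assume ij: "i < j" "i \<in> {..<q}" "j \<in> {..<q}"
      show "(\<sigma> ^^ i) z \<noteq> (\<sigma> ^^ j) z"
      proof
        assume eq: "(\<sigma> ^^ i) z = (\<sigma> ^^ j) z"
        have "(\<sigma> ^^ (j - i)) ((\<sigma> ^^ i) z) = (\<sigma> ^^ i) z"
          using ij eq by (metis add.commute comp_apply funpow_add le_add_diff_inverse less_imp_le)
        moreover have "coprime (j - i) q"
          using ij assms(1) by (simp add: coprime_commute nat_dvd_not_less prime_imp_coprime)
        ultimately have "\<sigma> ((\<sigma> ^^ i) z) = (\<sigma> ^^ i) z"
          using funpow_coprime_fixed[of "j - i" \<sigma> "(\<sigma> ^^ i) z" q] that ij funpow_closed[OF that(1,4)] by simp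
        then show False using that funpow_closed[OF that(1,4)] by blast
      qed
    qed auto
    have orbit_mem: "(\<sigma> ^^ n) z \<in> (\<lambda>i. (\<sigma> ^^ i) z) ` {..<q}" if "(\<sigma> ^^ q) z = z"
      for \<sigma> :: "'c \<Rightarrow> 'c" and z n
      using funpow_mod_eq[OF that, of n] q by (metis imageI lessThan_iff mod_less_divisor)
    have orbit_compl: "\<sigma> ` (Z - (\<lambda>i. (\<sigma> ^^ i) z) ` {..<q}) \<subseteq> Z - (\<lambda>i. (\<sigma> ^^ i) z) ` {..<q}"
      if "\<sigma> ` Z \<subseteq> Z" "\<And>z. z \<in> Z \<Longrightarrow> (\<sigma> ^^ q) z = z" "z \<in> Z" for \<sigma> :: "'c \<Rightarrow> 'c" and Z z
    proof -
      have "w \<in> (\<lambda>i. (\<sigma> ^^ i) z) ` {..<q}" if w: "w \<in> Z" "\<sigma> w = (\<sigma> ^^ i) z" for w i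
      proof -
        have "w = (\<sigma> ^^ (q - 1)) (\<sigma> w)"
          using that(1) q \<open>\<And>z. z \<in> Z \<Longrightarrow> (\<sigma> ^^ q) z = z\<close>
          by (metis Suc_diff_1 comp_apply funpow_Suc_right)
        then have "w = (\<sigma> ^^ (q - 1 + i)) z" using w by (simp add: funpow_add)
        then show ?thesis using orbit_mem \<open>\<And>z. z \<in> Z \<Longrightarrow> (\<sigma> ^^ q) z = z\<close> \<open>z \<in> Z\<close> by metis
      qed
      then show ?thesis using that(1) by auto
    qed
    define F where "F i = (f ^^ i) a" for i
    define G where "G i = (g ^^ i) b" for i
    have F: "inj_on F {..<q}" "F ` {..<q} \<subseteq> A" "f ` (A - F ` {..<q}) \<subseteq> A - F ` {..<q}"
      and Fq: "F (n mod q) = F n" for n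
      using orbit_inj[OF less.prems(4-6) a] orbit_compl[OF less.prems(4,5) a]
        funpow_closed[OF less.prems(4) a] funpow_mod_eq[OF less.prems(5)[OF a]]
      by (auto simp: F_def[abs_def])
    have G: "inj_on G {..<q}" "G ` {..<q} \<subseteq> B" "g ` (B - G ` {..<q}) \<subseteq> B - G ` {..<q}"
      and Gq: "G (n mod q) = G n" for n
      using orbit_inj[OF less.prems(7-9) b] orbit_compl[OF less.prems(7,8) b]
        funpow_closed[OF less.prems(7) b] funpow_mod_eq[OF less.prems(8)[OF b]]
      by (auto simp: G_def[abs_def])
    have cards: "card (A - F ` {..<q}) = card A - q" "card (B - G ` {..<q}) = card B - q"
      using F G less.prems by (simp_all add: card_Diff_subset card_image finite_subset)
    have "card A > 0" using False less.prems(1) by (simp only: card_gt_0_iff) simp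
    have "\<exists>h. bij_betw h (A - F ` {..<q}) (B - G ` {..<q}) \<and> (\<forall>z\<in>A - F ` {..<q}. h (f z) = g (h z))"
    proof (rule less.hyps)
      show "card (A - F ` {..<q}) < card A" using cards q \<open>card A > 0\<close> by simp
      show "finite (A - F ` {..<q})" "finite (B - G ` {..<q})" using less.prems by simp_all
      show "card (A - F ` {..<q}) = card (B - G ` {..<q})" using cards less.prems(3) by simp
    qed (use less.prems(5,6,8,9) F(3) G(3) in \<open>simp_all del: image_subset_iff\<close>)
    then obtain h where
      h: "bij_betw h (A - F ` {..<q}) (B - G ` {..<q})" "\<And>z. z \<in> A - F ` {..<q} \<Longrightarrow> h (f z) = g (h z)"
      by blast
    define H where "H z = (if z \<in> F ` {..<q} then G (inv_into {..<q} F z) else h z)" for z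
    have HF: "H (F i) = G i" for i
    proof -
      have "i mod q \<in> {..<q}" using q by simp
      then have "H (F (i mod q)) = G (i mod q)"
        using F(1) by (simp add: H_def inv_into_f_f)
      then show ?thesis by (simp add: Fq Gq)
    qed
    have "bij_betw H (F ` {..<q} \<union> (A - F ` {..<q})) (G ` {..<q} \<union> (B - G ` {..<q}))"
    proof (rule bij_betw_combine)
      show "bij_betw H (F ` {..<q}) (G ` {..<q})"
        using F(1) G(1) HF unfolding bij_betw_def by (auto simp: inj_on_def image_image)
      show "bij_betw H (A - F ` {..<q}) (B - G ` {..<q})"
        using h(1) by (rule bij_betw_cong[THEN iffD1, rotated]) (simp add: H_def)
    qed auto
    then have "bij_betw H A B" using F(2) G(2) by (simp add: Un_absorb1)
    moreover have "H (f z) = g (H z)" if "z \<in> A" for z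
    proof (cases "z \<in> F ` {..<q}")
      case True
      then obtain i where "z = F i" by auto
      moreover have "f (F i) = F (Suc i)" "g (G i) = G (Suc i)" by (simp_all add: F_def G_def)
      ultimately show ?thesis by (simp add: HF)
    next
      case False
      then have "f z \<notin> F ` {..<q}" using F(3) that by blast
      then show ?thesis using False h(2) that by (simp add: H_def)
    qed
    ultimately show ?thesis by blast
  qed
qed

lemma equivariant_bij:
  assumes "Factorial_Ring.prime q" "finite A" "finite B" "card A = card B"
    and f: "f ` A \<subseteq> A" "\<And>z. z \<in> A \<Longrightarrow> (f ^^ q) z = z"
    and g: "g ` B \<subseteq> B" "\<And>z. z \<in> B \<Longrightarrow> (g ^^ q) z = z"
    and same_fixed: "card {z \<in> A. f z = z} = card {z \<in> B. g z = z}"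
  obtains h where "bij_betw h A B" "\<And>z. z \<in> A \<Longrightarrow> h (f z) = g (h z)"
proof -
  have q: "q > 0" using assms(1) by (simp add: prime_gt_0_nat)
  have moved: "\<sigma> ` {z \<in> Z. \<sigma> z \<noteq> z} \<subseteq> {z \<in> Z. \<sigma> z \<noteq> z}"
    if "\<sigma> ` Z \<subseteq> Z" "\<And>z. z \<in> Z \<Longrightarrow> (\<sigma> ^^ q) z = z" for \<sigma> :: "'c \<Rightarrow> 'c" and Z
  proof -
    have "\<sigma> z = z" if z: "z \<in> Z" "\<sigma> (\<sigma> z) = \<sigma> z" for z
    proof -
      have "(\<sigma> ^^ n) (\<sigma> z) = \<sigma> z" for n using z(2) by (induction n) simp_all
      then show ?thesis
        using \<open>\<And>z. z \<in> Z \<Longrightarrow> (\<sigma> ^^ q) z = z\<close>[OF z(1)] q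
        by (metis Suc_diff_1 comp_apply funpow_Suc_right)
    qed
    then show ?thesis using that(1) by auto
  qed
  have split: "card {z \<in> Z. \<sigma> z \<noteq> z} = card Z - card {z \<in> Z. \<sigma> z = z}" if "finite Z"
    for \<sigma> :: "'c \<Rightarrow> 'c" and Z
  proof -
    have "{z \<in> Z. \<sigma> z \<noteq> z} = Z - {z \<in> Z. \<sigma> z = z}" by auto
    then show ?thesis using that by (simp add: card_Diff_subset)
  qed
  have "\<exists>h. bij_betw h {z \<in> A. f z \<noteq> z} {z \<in> B. g z \<noteq> z} \<and> (\<forall>z\<in>{z \<in> A. f z \<noteq> z}. h (f z) = g (h z))"
    by (rule equivariant_bij_fixpoint_free[OF assms(1)])
       (use assms moved[OF f] moved[OF g] split[OF assms(2)] split[OF assms(3)] in auto)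
  then obtain h1 where h1: "bij_betw h1 {z \<in> A. f z \<noteq> z} {z \<in> B. g z \<noteq> z}"
    "\<And>z. z \<in> A \<Longrightarrow> f z \<noteq> z \<Longrightarrow> h1 (f z) = g (h1 z)" by auto
  obtain h0 where h0: "bij_betw h0 {z \<in> A. f z = z} {z \<in> B. g z = z}"
    using finite_same_card_bij[OF _ _ same_fixed] assms(2,3) by auto
  define h where "h z = (if f z = z then h0 z else h1 z)" for z
  have "bij_betw h ({z \<in> A. f z = z} \<union> {z \<in> A. f z \<noteq> z}) ({z \<in> B. g z = z} \<union> {z \<in> B. g z \<noteq> z})"
  proof (rule bij_betw_combine)
    show "bij_betw h {z \<in> A. f z = z} {z \<in> B. g z = z}"
      using h0 by (rule bij_betw_cong[THEN iffD1, rotated]) (simp add: h_def)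
    show "bij_betw h {z \<in> A. f z \<noteq> z} {z \<in> B. g z \<noteq> z}"
      using h1(1) by (rule bij_betw_cong[THEN iffD1, rotated]) (simp add: h_def)
  qed auto
  moreover have "{z \<in> A. f z = z} \<union> {z \<in> A. f z \<noteq> z} = A" "{z \<in> B. g z = z} \<union> {z \<in> B. g z \<noteq> z} = B"
    by auto
  ultimately have "bij_betw h A B" by simp
  moreover have "h (f z) = g (h z)" if z: "z \<in> A" for z
  proof (cases "f z = z")
    case True
    then have "h0 z \<in> {z \<in> B. g z = z}" using h0 z by (auto simp: bij_betw_def)
    then show ?thesis using True by (simp add: h_def)
  next
    case False
    then have "f (f z) \<noteq> f z" using moved[OF f] z by auto
    then show ?thesis using False h1(2) z by (simp add: h_def)
  qed
  ultimately show thesis using that by blast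
qed

lemma bij_betw_if_funpow_id:
  assumes "f ` A \<subseteq> A" "\<And>z. z \<in> A \<Longrightarrow> (f ^^ q) z = z" "q > 0"
  shows "bij_betw f A A"
proof -
  obtain n where n: "q = Suc n" using assms(3) by (cases q) auto
  show ?thesis
  proof (rule bij_betw_byWitness[where f' = "f ^^ n"])
    show "\<forall>z\<in>A. (f ^^ n) (f z) = z" "\<forall>z\<in>A. f ((f ^^ n) z) = z"
      using assms(2) unfolding n by (simp_all add: funpow_swap1)
    show "(f ^^ n) ` A \<subseteq> A" using funpow_closed[OF assms(1)] by blast
  qed (rule assms(1))
qed

lemma funpow_mult_mod:
  "k \<in> {0..<int M} \<Longrightarrow> ((\<lambda>k. int a * k mod int M) ^^ m) k = int a ^ m * k mod int M"
  by (induction m) (simp_all add: mod_simps mult.assoc)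

lemma funpow_mult_mod_period:
  assumes "[a ^ q = 1] (mod M)" "k \<in> {0..<int M}"
  shows "((\<lambda>k. int a * k mod int M) ^^ q) k = k"
proof -
  have "[int (a ^ q) = int 1] (mod int M)" using assms(1) by (simp only: cong_int_iff)
  then have "[int a ^ q * k = 1 * k] (mod int M)" by (intro cong_mult) simp_all
  then show ?thesis using assms(2) funpow_mult_mod[OF assms(2)] by (simp add: cong_def)
qed

text \<open>Zero is excluded as a label, so multiplication by \<open>a\<close> must preserve nonzero residues.\<close>
lemma mult_mod_ne_0:
  assumes "[a ^ q = 1] (mod M)" "q > 0" "k \<in> {0..<int M}" "k \<noteq> 0"
  shows "int a * k mod int M \<noteq> 0"
proof
  assume "int a * k mod int M = 0"
  then have "int M dvd int a * k" by (simp add: dvd_eq_mod_eq_0)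
  moreover have "int a * k dvd int a ^ q * k" using assms(2) by (intro mult_dvd_mono dvd_power) simp_all
  ultimately have "int a ^ q * k mod int M = 0" using dvd_trans by (simp only: mod_eq_0_iff_dvd) blast
  then show False
    using funpow_mult_mod_period[OF assms(1,3)] funpow_mult_mod[OF assms(3), of q a] assms(4) by simp
qed

text \<open>A suitable power of a primitive root has order \<open>q\<close>; adding the odd number \<open>p\<close> if necessary makes it odd,
which is what makes it a unit modulo \<open>2 * p\<close>.\<close>
lemma odd_element_of_prime_order:
  assumes "Factorial_Ring.prime p" "Factorial_Ring.prime q" "odd p" "q dvd p - 1"
  obtains a :: nat where "odd a" "[a ^ q = 1] (mod p)" "\<not> [a = 1] (mod p)"
proof -
  have "p > 1" using assms(1) by (rule prime_gt_1_nat)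
  obtain g where ord: "ord p g = p - 1"
    using residue_prime_has_primroot[OF assms(1)] by blast
  obtain e where e: "p - 1 = q * e" using assms(4) by (elim dvdE)
  define b where "b = g ^ e"
  have "[b ^ q = 1] (mod p)"
    unfolding b_def power_mult[symmetric] using e ord ord_divides[of g "e * q" p] by (simp add: mult.commute)
  moreover have "\<not> [b = 1] (mod p)"
  proof
    assume "[b = 1] (mod p)"
    then have "p - 1 dvd e" unfolding b_def using ord ord_divides[of g e p] by simp
    moreover have "e > 0" using e \<open>p > 1\<close> by (cases e) auto
    ultimately have "q * e \<le> e" using e dvd_imp_le by metis
    then show False using \<open>e > 0\<close> prime_gt_1_nat[OF assms(2)] by simp
  qed
  moreover define a where "a = (if odd b then b else b + p)"
  have "odd a" using assms(3) by (simp add: a_def)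
  moreover have "[a = b] (mod p)" by (simp add: a_def cong_def)
  ultimately show thesis using that[of a] by (meson cong_pow cong_sym cong_trans)
qed

section \<open>Vectors modulo a prime and hyperplanes\<close>

lemma geometric_sum_nat:
  assumes "q > (0::nat)"
  shows "(q - 1) * (\<Sum>i<m. q ^ i) = q ^ m - 1"
proof -
  obtain t where t: "q = Suc t" using assms by (cases q) auto
  have "t * (\<Sum>i<m. q ^ i) + 1 = q ^ m" by (induction m) (simp_all add: t algebra_simps)
  then show ?thesis unfolding t by simp
qed

lemma sum_mod_mult_mod: "(\<Sum>i\<in>A. (f i mod m) * g i) mod m = (\<Sum>i\<in>A. f i * g i) mod (m::int)"
proof -
  have "(\<Sum>i\<in>A. (f i mod m) * g i) mod m = (\<Sum>i\<in>A. ((f i mod m) * g i) mod m) mod m"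
    by (rule mod_sum_eq[symmetric])
  also have "\<dots> = (\<Sum>i\<in>A. (f i * g i) mod m) mod m" by (simp add: mod_mult_left_eq)
  also have "\<dots> = (\<Sum>i\<in>A. f i * g i) mod m" by (rule mod_sum_eq)
  finally show ?thesis .
qed

locale residue_vectors =
  fixes q s :: nat
  assumes prime: "Factorial_Ring.prime q"
begin

definition E :: "(nat \<Rightarrow> int) monoid" where
  "E = product_group {..s} (\<lambda>_. integer_mod_group q)"

definition vec :: "(nat \<Rightarrow> int) \<Rightarrow> nat \<Rightarrow> int" where
  "vec f = (\<lambda>i\<in>{..s}. f i mod int q)"

definition dot :: "(nat \<Rightarrow> int) \<Rightarrow> (nat \<Rightarrow> int) \<Rightarrow> int" where
  "dot u w = (\<Sum>i\<le>s. u i * w i) mod int q"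

text \<open>Vectors whose last nonzero coordinate is \<open>1\<close>: one representative for each line, hence, through \<open>dot\<close>, one
normal vector for each hyperplane. Normalizing the last coordinate rather than the first is what makes the
set invariant under the map \<open>coshear\<close> below.\<close>
definition normalized :: "(nat \<Rightarrow> int) set" where
  "normalized = {w \<in> carrier E. \<exists>l\<le>s. w l = 1 \<and> (\<forall>i. l < i \<and> i \<le> s \<longrightarrow> w i = 0)}"

lemma q_gt_1: "q > 1" using prime by (rule prime_gt_1_nat)

lemma q_pos: "q > 0" using q_gt_1 by simp

lemma prime_int: "Factorial_Ring.prime (int q)" using prime by simp

lemma mem_E: "u \<in> carrier E \<longleftrightarrow> (\<forall>i\<le>s. 0 \<le> u i \<and> u i < int q) \<and> (\<forall>i>s. u i = undefined)"
  using q_pos by (auto simp: E_def carrier_integer_mod_group PiE_def extensional_def Pi_def)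

lemma coord_mod: "u \<in> carrier E \<Longrightarrow> i \<le> s \<Longrightarrow> u i mod int q = u i"
  by (simp add: mem_E)

lemma vec_eqI: "\<lbrakk>u \<in> carrier E; v \<in> carrier E; \<And>i. i \<le> s \<Longrightarrow> u i = v i\<rbrakk> \<Longrightarrow> u = v"
  unfolding mem_E by (rule ext) (metis not_le)

lemma vec_in_E: "vec f \<in> carrier E"
  using q_pos by (simp add: mem_E vec_def)

lemma vec_nth: "i \<le> s \<Longrightarrow> vec f i = f i mod int q"
  by (simp add: vec_def)

lemma mult_E: "u \<otimes>\<^bsub>E\<^esub> v = vec (\<lambda>i. u i + v i)"
  by (simp add: E_def vec_def)

lemma one_E: "\<one>\<^bsub>E\<^esub> = vec (\<lambda>i. 0)"
  by (simp add: E_def vec_def)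

lemma group_E: "group E" by (simp add: E_def)

lemma finite_E: "finite (carrier E)"
  using q_pos by (auto simp: E_def carrier_integer_mod_group intro: finite_PiE)

lemma order_E: "order E = q ^ (s + 1)"
  using q_pos by (simp add: order_def E_def carrier_integer_mod_group card_PiE)

lemma dot_vec: "dot (vec f) w = (\<Sum>i\<le>s. f i * w i) mod int q"
proof -
  have "(\<Sum>i\<le>s. vec f i * w i) = (\<Sum>i\<le>s. (f i mod int q) * w i)"
    by (simp add: vec_nth)
  then show ?thesis unfolding dot_def by (simp only: sum_mod_mult_mod)
qed

lemma dot_commute: "dot u w = dot w u"
  by (simp add: dot_def mult.commute)

lemma dot_mult: "dot (u \<otimes>\<^bsub>E\<^esub> v) w = (dot u w + dot v w) mod int q"
  unfolding mult_E dot_vec by (simp add: dot_def distrib_right sum.distrib mod_add_eq)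

lemma dot_in: "dot u w \<in> carrier (integer_mod_group q)"
  using q_pos by (simp add: dot_def carrier_integer_mod_group)

lemma dot_one: "dot \<one>\<^bsub>E\<^esub> w = 0"
  unfolding one_E dot_vec by simp

lemma dot_unit: "w \<in> carrier E \<Longrightarrow> i \<le> s \<Longrightarrow> dot (vec (\<lambda>j. if j = i then 1 else 0)) w = w i"
  unfolding dot_vec by (simp add: if_distrib[of "\<lambda>x. x * _"] coord_mod cong: if_cong)

lemma dot_cancel:
  assumes "v \<in> carrier E" "w \<in> carrier E" "\<And>u. u \<in> carrier E \<Longrightarrow> dot u v = dot u w"
  shows "v = w"
  using assms by (metis dot_unit vec_eqI vec_in_E)

lemma inverse_mod:
  assumes "x mod int q \<noteq> 0"
  obtains d where "1 \<le> d" "d < int q" "(x * d) mod int q = 1"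
proof -
  have "\<not> int q dvd x" using assms by (simp add: dvd_eq_mod_eq_0)
  then have "coprime x (int q)"
    using prime_imp_coprime[OF prime_int] by (simp add: coprime_commute)
  then obtain e where e: "[x * e = 1] (mod int q)" using cong_solve_coprime_int by blast
  let ?d = "e mod int q"
  have 1: "(x * ?d) mod int q = 1"
    using e q_gt_1 by (simp add: cong_def mod_mult_right_eq)
  then have "?d \<noteq> 0" by auto
  moreover have "0 \<le> ?d" "?d < int q" using q_pos by simp_all
  ultimately show thesis using 1 that[of ?d] by linarith
qed

lemma dot_hom: "(\<lambda>u. dot u w) \<in> hom E (integer_mod_group q)"
  using dot_in dot_mult by (intro homI) (simp_all)

lemma dot_surj:
  assumes "w \<in> carrier E" "w \<noteq> \<one>\<^bsub>E\<^esub>" "c \<in> carrier (integer_mod_group q)"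
  shows "\<exists>u\<in>carrier E. dot u w = c"
proof -
  obtain i where i: "i \<le> s" "w i \<noteq> 0"
    using assms(1,2) vec_eqI[OF assms(1) vec_in_E, of "\<lambda>_. 0"] by (auto simp: one_E vec_nth)
  then obtain d where d: "(w i * d) mod int q = 1"
    using inverse_mod[of "w i"] coord_mod[OF assms(1)] by metis
  have "dot (vec (\<lambda>j. if j = i then c * d else 0)) w = (c * (w i * d)) mod int q"
    unfolding dot_vec using i by (simp add: if_distrib[of "\<lambda>x. x * _"] cong: if_cong) (simp add: ac_simps)
  also have "\<dots> = (c * ((w i * d) mod int q)) mod int q" by (simp add: mod_mult_right_eq)
  also have "\<dots> = c" using d assms(3) q_pos by (simp add: carrier_integer_mod_group)
  finally show ?thesis using vec_in_E by blast
qed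

lemma card_dot_fiber:
  assumes "w \<in> carrier E" "w \<noteq> \<one>\<^bsub>E\<^esub>" "c \<in> carrier (integer_mod_group q)"
  shows "card {u \<in> carrier E. dot u w = c} = q ^ s"
proof -
  have "(\<lambda>u. dot u w) ` carrier E = carrier (integer_mod_group q)"
    using dot_in dot_surj[OF assms(1,2)] by (intro equalityI subsetI) (force)+
  then have "card {u \<in> carrier E. dot u w = c} * card (carrier (integer_mod_group q)) = card (carrier E)"
    using card_fiber_surj_hom[OF group_E group_integer_mod_group dot_hom _ finite_E assms(3)] by blast
  then show ?thesis
    using q_pos order_E by (simp add: order_def carrier_integer_mod_group)
qed

lemma normalized_in_E: "w \<in> normalized \<Longrightarrow> w \<in> carrier E"
  by (simp add: normalized_def)

lemma normalized_ne_one: "w \<in> normalized \<Longrightarrow> w \<noteq> \<one>\<^bsub>E\<^esub>"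
  by (auto simp: normalized_def one_E vec_nth)

text \<open>Distinct normalized vectors are linearly independent, expressed by a nonvanishing two by two minor.\<close>
lemma normalized_minor:
  assumes "w \<in> normalized" "w' \<in> normalized" "w \<noteq> w'"
  obtains i j where "i \<le> s" "j \<le> s" "(w i * w' j - w j * w' i) mod int q \<noteq> 0"
proof -
  obtain l where l: "l \<le> s" "w l = 1" "\<And>i. l < i \<Longrightarrow> i \<le> s \<Longrightarrow> w i = 0"
    using assms(1) by (auto simp: normalized_def)
  obtain l' where l': "l' \<le> s" "w' l' = 1" "\<And>i. l' < i \<Longrightarrow> i \<le> s \<Longrightarrow> w' i = 0"
    using assms(2) by (auto simp: normalized_def)
  consider "l < l'" | "l' < l" | "l = l'" by linarith
  then show thesis
  proof cases
    case 1
    then show thesis using that[of l l'] l l' q_gt_1 by simp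
  next
    case 2
    then show thesis using that[of l' l] l l' q_gt_1 by (simp add: zmod_minus1)
  next
    case 3
    obtain i where i: "i \<le> s" "w i \<noteq> w' i"
      using vec_eqI[OF normalized_in_E[OF assms(1)] normalized_in_E[OF assms(2)]] assms(3) by blast
    have "w i mod int q \<noteq> w' i mod int q"
      using i coord_mod normalized_in_E assms by simp
    then have "(w i - w' i) mod int q \<noteq> 0" by (simp add: mod_eq_dvd_iff dvd_eq_mod_eq_0)
    then show thesis using that[of i l] i 3 l l' by simp
  qed
qed

text \<open>By Cramer's rule for a nonvanishing minor the two functionals take all pairs of values, hence each pair
equally often.\<close>
lemma card_two_dot_fibers:
  assumes "w \<in> normalized" "w' \<in> normalized" "w \<noteq> w'"
    and "a \<in> carrier (integer_mod_group q)" "b \<in> carrier (integer_mod_group q)"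
  shows "card {u \<in> carrier E. dot u w = a \<and> dot u w' = b} * q ^ 2 = q ^ (s + 1)"
proof -
  let ?Z = "integer_mod_group q"
  let ?f = "\<lambda>u. (dot u w, dot u w')"
  obtain i j where ij: "i \<le> s" "j \<le> s" "(w i * w' j - w j * w' i) mod int q \<noteq> 0"
    using normalized_minor[OF assms(1-3)] .
  obtain d where d: "((w i * w' j - w j * w' i) * d) mod int q = 1"
    using inverse_mod[OF ij(3)] .
  have "i \<noteq> j" using ij(3) by auto
  have "\<exists>u\<in>carrier E. dot u w = x \<and> dot u w' = y" if xy: "x \<in> carrier ?Z" "y \<in> carrier ?Z" for x y
  proof -
    define \<alpha> where "\<alpha> = (x * w' j - y * w j) * d"
    define \<beta> where "\<beta> = (y * w i - x * w' i) * d"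
    define u where "u = vec (\<lambda>k. if k = i then \<alpha> else if k = j then \<beta> else 0)"
    have sum: "dot u v = (\<alpha> * v i + \<beta> * v j) mod int q" for v
    proof -
      have "(\<Sum>k\<le>s. (if k = i then \<alpha> else if k = j then \<beta> else 0) * v k) =
            (\<Sum>k\<le>s. (if k = i then \<alpha> * v k else 0) + (if k = j then \<beta> * v k else 0))"
        using \<open>i \<noteq> j\<close> by (intro sum.cong) auto
      then show ?thesis using ij by (simp add: u_def dot_vec sum.distrib)
    qed
    have unit: "(z * ((w i * w' j - w j * w' i) * d)) mod int q = z" if "z \<in> carrier ?Z" for z
      using that d q_pos mod_mult_right_eq[of z "(w i * w' j - w j * w' i) * d" "int q"]
      by (simp add: carrier_integer_mod_group)
    have "\<alpha> * w i + \<beta> * w j = x * ((w i * w' j - w j * w' i) * d)"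
      "\<alpha> * w' i + \<beta> * w' j = y * ((w i * w' j - w j * w' i) * d)"
      by (simp_all add: \<alpha>_def \<beta>_def algebra_simps)
    then have "dot u w = x" "dot u w' = y" using sum unit xy by simp_all
    moreover have "u \<in> carrier E" unfolding u_def by (rule vec_in_E)
    ultimately show ?thesis by blast
  qed
  then have surj: "?f ` carrier E = carrier (?Z \<times>\<times> ?Z)"
    using dot_in by (intro equalityI subsetI) (force)+
  have "?f \<in> hom E (?Z \<times>\<times> ?Z)"
    using dot_in dot_mult by (intro homI) (simp_all)
  then have "card {u \<in> carrier E. ?f u = (a, b)} * card (carrier (?Z \<times>\<times> ?Z)) = card (carrier E)"
    using assms(4,5) surj
    by (intro card_fiber_surj_hom DirProd_group group_E group_integer_mod_group finite_E) auto
  then show ?thesis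
    using q_pos order_E
    by (simp add: order_def carrier_integer_mod_group card_cartesian_product power2_eq_square)
qed

text \<open>Every nonzero vector is a unique nonzero multiple of a normalized one.\<close>
lemma card_normalized:
  assumes "S \<subseteq> carrier E"
    and scale: "\<And>c w. w \<in> S \<Longrightarrow> vec (\<lambda>i. c * w i) \<in> S"
  shows "(q - 1) * card (S \<inter> normalized) = card (S - {\<one>\<^bsub>E\<^esub>})"
proof -
  let ?m = "\<lambda>(c, w). vec (\<lambda>i. c * w i)"
  have "bij_betw ?m ({1..<int q} \<times> (S \<inter> normalized)) (S - {\<one>\<^bsub>E\<^esub>})"
    unfolding bij_betw_def
  proof
    show "inj_on ?m ({1..<int q} \<times> (S \<inter> normalized))"
    proof (clarsimp simp: inj_on_def)
      fix c w c' w'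
      assume c: "1 \<le> c" "c < int q" "1 \<le> c'" "c' < int q"
        and w: "w \<in> normalized" "w' \<in> normalized"
        and eq: "vec (\<lambda>i. c * w i) = vec (\<lambda>i. c' * w' i)"
      have eq': "(c * w i) mod int q = (c' * w' i) mod int q" if "i \<le> s" for i
        using fun_cong[OF eq, of i] that by (simp add: vec_nth)
      obtain l where l: "l \<le> s" "w l = 1" "\<And>i. l < i \<Longrightarrow> i \<le> s \<Longrightarrow> w i = 0"
        using w(1) by (auto simp: normalized_def)
      obtain l' where l': "l' \<le> s" "w' l' = 1" "\<And>i. l' < i \<Longrightarrow> i \<le> s \<Longrightarrow> w' i = 0"
        using w(2) by (auto simp: normalized_def)
      have "\<not> l < l'" using eq'[of l'] l l' c by auto
      moreover have "\<not> l' < l" using eq'[of l] l l' c by auto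
      ultimately have "l = l'" by simp
      then have cc: "c = c'" using eq'[of l] l l' c by simp
      have "w i = w' i" if "i \<le> s" for i
      proof -
        have "[c * w i = c * w' i] (mod int q)" using eq'[OF that] cc by (simp add: cong_def)
        moreover have "coprime c (int q)"
          using c prime_imp_coprime[OF prime_int, of c] by (simp add: coprime_commute zdvd_not_zless)
        ultimately have "[w i = w' i] (mod int q)" by (simp add: cong_mult_lcancel)
        then show ?thesis using coord_mod w normalized_in_E that by (simp add: cong_def)
      qed
      then show "c = c' \<and> w = w'" using cc vec_eqI normalized_in_E w by blast
    qed
    show "?m ` ({1..<int q} \<times> (S \<inter> normalized)) = S - {\<one>\<^bsub>E\<^esub>}"
    proof (intro equalityI subsetI)
      fix v assume "v \<in> ?m ` ({1..<int q} \<times> (S \<inter> normalized))"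
      then obtain c w where cw: "1 \<le> c" "c < int q" "w \<in> S" "w \<in> normalized" "v = vec (\<lambda>i. c * w i)"
        by auto
      obtain l where l: "l \<le> s" "w l = 1" using cw by (auto simp: normalized_def)
      then have "v l \<noteq> 0" using cw by (simp add: vec_nth)
      then have "v \<noteq> \<one>\<^bsub>E\<^esub>" using l by (auto simp: one_E vec_nth)
      then show "v \<in> S - {\<one>\<^bsub>E\<^esub>}" using cw scale by simp
    next
      fix v assume v: "v \<in> S - {\<one>\<^bsub>E\<^esub>}"
      then have vE: "v \<in> carrier E" using assms(1) by blast
      let ?I = "{i. i \<le> s \<and> v i \<noteq> 0}"
      have "?I \<noteq> {}"
      proof
        assume "?I = {}"
        then have "v = \<one>\<^bsub>E\<^esub>" unfolding one_E by (intro vec_eqI[OF vE vec_in_E]) (auto simp: vec_nth)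
        then show False using v by simp
      qed
      define l where "l = Max ?I"
      have "l \<in> ?I" unfolding l_def by (rule Max_in) (use \<open>?I \<noteq> {}\<close> in auto)
      then have l: "l \<le> s" "v l \<noteq> 0" by auto
      have above: "v i = 0" if "l < i" "i \<le> s" for i
        using Max_ge[of ?I i] that by (fastforce simp: l_def)
      obtain d where d: "1 \<le> d" "d < int q" "(v l * d) mod int q = 1"
        using inverse_mod[of "v l"] l coord_mod[OF vE] by metis
      let ?w = "vec (\<lambda>i. d * v i)"
      have "?w \<in> S" using scale v by blast
      moreover have "?w \<in> normalized"
        using l d above vec_in_E by (auto simp: normalized_def vec_nth mult.commute)
      moreover have "v = vec (\<lambda>i. v l * ?w i)"
      proof (rule vec_eqI[OF vE vec_in_E])
        fix i assume i: "i \<le> s"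
        have "(v l * (d * v i)) mod int q = ((v l * d) mod int q * v i) mod int q"
          by (simp add: mod_mult_left_eq mult.assoc)
        then show "v i = vec (\<lambda>i. v l * ?w i) i"
          using i d coord_mod[OF vE i] by (simp add: vec_nth mod_mult_right_eq)
      qed
      moreover have "v l \<in> {1..<int q}" using l vE by (force simp: mem_E)
      ultimately show "v \<in> ?m ` ({1..<int q} \<times> (S \<inter> normalized))" by (intro image_eqI[of _ _ "(v l, ?w)"]) auto
    qed
  qed
  then have "card ({1..<int q} \<times> (S \<inter> normalized)) = card (S - {\<one>\<^bsub>E\<^esub>})"
    by (rule bij_betw_same_card)
  then show ?thesis using q_pos by (simp add: card_cartesian_product nat_diff_distrib)
qed

lemma card_all_normalized: "(q - 1) * card normalized = q ^ (s + 1) - 1"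
proof -
  have "carrier E \<inter> normalized = normalized" using normalized_in_E by blast
  moreover have "\<one>\<^bsub>E\<^esub> \<in> carrier E" unfolding one_E by (rule vec_in_E)
  ultimately show ?thesis
    using card_normalized[of "carrier E"] vec_in_E order_E finite_E
    by (simp add: order_def card_Diff_singleton)
qed

text \<open>This counts the hyperplanes through a nonzero vector.\<close>
lemma card_normalized_orthogonal:
  assumes "g \<in> carrier E" "g \<noteq> \<one>\<^bsub>E\<^esub>"
  shows "(q - 1) * card {w \<in> normalized. dot g w = 0} = q ^ s - 1"
proof -
  let ?S = "{w \<in> carrier E. dot w g = 0}"
  have "(q - 1) * card (?S \<inter> normalized) = card (?S - {\<one>\<^bsub>E\<^esub>})"
  proof (rule card_normalized)
    fix c w assume "w \<in> ?S"
    then have "(\<Sum>i\<le>s. w i * g i) mod int q = 0" by (simp add: dot_def)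
    moreover have "(\<Sum>i\<le>s. c * w i * g i) = c * (\<Sum>i\<le>s. w i * g i)"
      by (simp add: sum_distrib_left mult.assoc)
    ultimately have "dot (vec (\<lambda>i. c * w i)) g = 0" unfolding dot_vec by auto
    then show "vec (\<lambda>i. c * w i) \<in> ?S" using vec_in_E by blast
  qed blast
  moreover have "?S \<inter> normalized = {w \<in> normalized. dot g w = 0}"
    using normalized_in_E dot_commute by fastforce
  moreover have "card (?S - {\<one>\<^bsub>E\<^esub>}) = q ^ s - 1"
  proof -
    have "\<one>\<^bsub>E\<^esub> \<in> ?S" using dot_one vec_in_E unfolding one_E by simp
    moreover have "card ?S = q ^ s" by (rule card_dot_fiber[OF assms]) simp
    ultimately show ?thesis using finite_E by (simp add: card_Diff_singleton)
  qed
  ultimately show ?thesis by simp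
qed

section \<open>A unipotent map and its adjoint\<close>

text \<open>A single unipotent Jordan block. The companion \<open>coshear\<close> is its adjoint for \<open>dot\<close>: it sends
the normal vector of a hyperplane to that of the preimage under \<open>shear\<close>.\<close>
definition shear :: "(nat \<Rightarrow> int) \<Rightarrow> nat \<Rightarrow> int" where
  "shear u = vec (\<lambda>i. u i + (if i = 0 then 0 else u (i - 1)))"

definition coshear :: "(nat \<Rightarrow> int) \<Rightarrow> nat \<Rightarrow> int" where
  "coshear w = vec (\<lambda>i. w i + (if i = s then 0 else w (Suc i)))"

lemma dot_vec_right: "dot u (vec f) = (\<Sum>i\<le>s. u i * f i) mod int q"
  using dot_vec[of f u] by (simp add: dot_commute mult.commute)

lemma dot_shear: "dot (shear u) w = dot u (coshear w)"
proof -
  have "(\<Sum>i\<le>s. (if i = 0 then 0 else u (i - 1)) * w i) = (\<Sum>i\<le>s. u i * (if i = s then 0 else w (Suc i)))"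
  proof (cases s)
    case (Suc t)
    have "(\<Sum>i\<le>s. (if i = 0 then 0 else u (i - 1)) * w i) = (\<Sum>i\<le>t. u i * w (Suc i))"
      unfolding Suc by (subst sum.atMost_Suc_shift) simp
    moreover have "(\<Sum>i\<le>s. u i * (if i = s then 0 else w (Suc i))) = (\<Sum>i\<le>t. u i * w (Suc i))"
      unfolding Suc by simp
    ultimately show ?thesis by simp
  qed simp
  then show ?thesis
    unfolding shear_def coshear_def dot_vec dot_vec_right by (simp add: algebra_simps sum.distrib)
qed

lemma shear_in_E: "shear u \<in> carrier E"
  unfolding shear_def by (rule vec_in_E)

lemma coshear_in_E: "coshear u \<in> carrier E"
  unfolding coshear_def by (rule vec_in_E)

lemma shear_mult: "shear (u \<otimes>\<^bsub>E\<^esub> v) = shear u \<otimes>\<^bsub>E\<^esub> shear v"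
proof (rule vec_eqI)
  fix i assume "i \<le> s"
  then show "shear (u \<otimes>\<^bsub>E\<^esub> v) i = (shear u \<otimes>\<^bsub>E\<^esub> shear v) i"
    by (cases i) (simp_all add: mult_E shear_def vec_nth mod_simps, simp add: algebra_simps)
qed (simp_all add: mult_E shear_def vec_in_E)

lemma shear_0: "u \<in> carrier E \<Longrightarrow> shear u 0 = u 0"
  by (simp add: shear_def vec_nth coord_mod)

text \<open>This is \<open>(1 + N) ^ n = (\<Sum>j. (n choose j) N ^ j)\<close> for the nilpotent shift \<open>N\<close>.\<close>
lemma shear_funpow_nth:
  assumes "u \<in> carrier E" "i \<le> s"
  shows "(shear ^^ n) u i = (\<Sum>j\<le>i. int (n choose j) * u (i - j)) mod int q"
  using assms(2)
proof (induction n arbitrary: i)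
  case 0
  have "(\<Sum>j\<le>i. int (0 choose j) * u (i - j)) = (\<Sum>j\<in>{0}. int (0 choose j) * u (i - j))"
    by (rule sum.mono_neutral_right) (auto simp: binomial_eq_0)
  then show ?case using 0 by (simp add: coord_mod[OF assms(1)])
next
  case (Suc n)
  show ?case
  proof (cases i)
    case 0
    then show ?thesis using Suc.IH[of 0] by (simp add: shear_def vec_nth)
  next
    case (Suc k)
    let ?c = "\<lambda>n i. \<Sum>j\<le>i. int (n choose j) * u (i - j)"
    have "?c (Suc n) (Suc k) = u (Suc k) + (\<Sum>j\<le>k. int (n choose Suc j) * u (k - j)) + ?c n k"
      by (subst sum.atMost_Suc_shift) (simp add: algebra_simps sum.distrib)
    also have "u (Suc k) + (\<Sum>j\<le>k. int (n choose Suc j) * u (k - j)) = ?c n (Suc k)"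
      by (subst sum.atMost_Suc_shift) simp
    finally have "?c (Suc n) i = ?c n i + ?c n k" using Suc by simp
    moreover have "(shear ^^ Suc n) u i = ((shear ^^ n) u i + (shear ^^ n) u k) mod int q"
      using Suc Suc.prems by (simp add: shear_def vec_nth)
    ultimately show ?thesis
      using Suc.IH[of i] Suc.IH[of k] Suc Suc.prems by (simp add: mod_add_eq)
  qed
qed

lemma shear_funpow_in_E: "u \<in> carrier E \<Longrightarrow> (shear ^^ n) u \<in> carrier E"
  by (induction n) (simp_all add: shear_in_E)

lemma coshear_funpow_in_E: "u \<in> carrier E \<Longrightarrow> (coshear ^^ n) u \<in> carrier E"
  by (induction n) (simp_all add: coshear_in_E)

text \<open>Only the coefficients \<open>q choose j\<close> with \<open>j \<le> s < q\<close> occur, and all but the first are divisible by \<open>q\<close>.\<close>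
lemma shear_funpow_q:
  assumes "s < q" "u \<in> carrier E"
  shows "(shear ^^ q) u = u"
proof (rule vec_eqI[OF shear_funpow_in_E[OF assms(2)] assms(2)])
  fix i assume i: "i \<le> s"
  have "int (q choose j) * u (i - j) mod int q = 0" if "j \<in> {..i} - {0}" for j
  proof -
    have "q dvd (q choose j)" using that i assms(1) prime by (intro dvd_choose_prime) auto
    then have "int q dvd int (q choose j)" by simp
    then show ?thesis by simp
  qed
  then have "(\<Sum>j\<in>{..i} - {0}. int (q choose j) * u (i - j)) mod int q = 0"
    using mod_sum_eq[of "\<lambda>j. int (q choose j) * u (i - j)" "int q" "{..i} - {0}", symmetric] by simp
  then have "(\<Sum>j\<le>i. int (q choose j) * u (i - j)) mod int q = u i mod int q"
    by (subst sum.remove[of _ 0]) (simp_all add: mod_add_right_eq[symmetric])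
  then show "(shear ^^ q) u i = u i"
    using shear_funpow_nth[OF assms(2) i] coord_mod[OF assms(2) i] by simp
qed

lemma dot_shear_funpow: "dot ((shear ^^ n) u) w = dot u ((coshear ^^ n) w)"
proof (induction n arbitrary: w)
  case (Suc n)
  have "dot ((shear ^^ Suc n) u) w = dot ((shear ^^ n) u) (coshear w)" by (simp add: dot_shear)
  then show ?case by (simp only: Suc.IH funpow_Suc_right comp_apply)
qed simp

lemma coshear_funpow_q:
  assumes "s < q" "w \<in> carrier E"
  shows "(coshear ^^ q) w = w"
  by (rule dot_cancel[OF coshear_funpow_in_E[OF assms(2)] assms(2)])
     (simp add: dot_shear_funpow[symmetric] shear_funpow_q[OF assms(1)])

lemma coshear_normalized: "coshear ` normalized \<subseteq> normalized"
proof safe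
  fix w assume w: "w \<in> normalized"
  then obtain l where l: "l \<le> s" "w l = 1" "\<And>i. l < i \<Longrightarrow> i \<le> s \<Longrightarrow> w i = 0"
    by (auto simp: normalized_def)
  have "coshear w l = 1" "\<And>i. l < i \<Longrightarrow> i \<le> s \<Longrightarrow> coshear w i = 0"
    using l q_gt_1 by (auto simp: coshear_def vec_nth)
  then show "coshear w \<in> normalized" using l coshear_in_E by (auto simp: normalized_def)
qed

text \<open>A fixed vector has all coordinates beyond the first equal to zero, and normalization leaves only one.\<close>
lemma coshear_fixed: "{w \<in> normalized. coshear w = w} = {vec (\<lambda>i. if i = 0 then 1 else 0)}"
proof (intro equalityI subsetI)
  fix w assume "w \<in> {w \<in> normalized. coshear w = w}"
  then have w: "w \<in> normalized" "coshear w = w" by auto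
  have wE: "w \<in> carrier E" using w normalized_in_E by blast
  have 0: "w (Suc i) = 0" if "Suc i \<le> s" for i
  proof -
    have "w i = (w i + w (Suc i)) mod int q"
      using fun_cong[OF w(2), of i] that by (auto simp: coshear_def vec_nth)
    then have "[w i + 0 = w i + w (Suc i)] (mod int q)"
      using coord_mod[OF wE, of i] that by (simp add: cong_def)
    then have "[0 = w (Suc i)] (mod int q)" using cong_add_lcancel by blast
    then show ?thesis using coord_mod[OF wE that] by (simp add: cong_def)
  qed
  have tail: "w i = 0" if "i \<le> s" "i \<noteq> 0" for i
    using 0[of "i - 1"] that by simp
  obtain l where l: "l \<le> s" "w l = 1" using w by (auto simp: normalized_def)
  then have "w 0 = 1" using tail[of l] by (cases "l = 0") auto
  then have "w = vec (\<lambda>i. if i = 0 then 1 else 0)"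
    using tail q_gt_1 by (intro vec_eqI[OF wE vec_in_E]) (auto simp: vec_nth)
  then show "w \<in> {vec (\<lambda>i. if i = 0 then 1 else 0)}" by simp
next
  fix w assume "w \<in> {vec (\<lambda>i. if i = 0 then 1 else 0) :: nat \<Rightarrow> int}"
  then have w: "w = vec (\<lambda>i. if i = 0 then 1 else 0)" by simp
  have wE: "w \<in> carrier E" unfolding w by (rule vec_in_E)
  have "coshear w = w"
    using q_gt_1 by (intro vec_eqI[OF coshear_in_E wE]) (auto simp: coshear_def w vec_nth)
  moreover have "w \<in> normalized"
    using wE q_gt_1 by (auto simp: normalized_def w vec_nth intro!: exI[of _ 0])
  ultimately show "w \<in> {w \<in> normalized. coshear w = w}" by simp
qed

end

section \<open>The invariant difference set and the twisted group\<close>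

text \<open>A labelling \<open>\<eta>\<close> of the hyperplanes, given by their normalized normal vectors, by the nonzero residues modulo
\<open>M\<close>. Equivariance is stated for the adjoint: the hyperplane labelled \<open>a * k\<close> has to be the image under
\<open>shear\<close> of the one labelled \<open>k\<close>, and pulling back along \<open>shear\<close> applies \<open>coshear\<close> to the normal vector.
The equation for \<open>M\<close> says that there are exactly \<open>M - 1\<close> hyperplanes.\<close>
locale equivariant_labelling = residue_vectors +
  fixes M a :: nat and \<eta> :: "int \<Rightarrow> nat \<Rightarrow> int"
  assumes s_ge_2: "2 \<le> s" and s_less_q: "s < q"
    and M: "(q - 1) * (M - 1) = q ^ (s + 1) - 1"
    and a_power: "[a ^ q = 1] (mod M)" and a_ne_1: "\<not> [a = 1] (mod M)"
    and \<eta>_bij: "bij_betw \<eta> ({0..<int M} - {0}) normalized"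
    and \<eta>_equivariant: "k \<in> {0..<int M} - {0} \<Longrightarrow> coshear (\<eta> (int a * k mod int M)) = \<eta> k"
begin

definition K :: "int monoid" where "K = integer_mod_group M"

definition \<alpha> :: "int \<Rightarrow> int" where "\<alpha> k = int a * k mod int M"

definition hyperplane :: "int \<Rightarrow> (nat \<Rightarrow> int) set" where
  "hyperplane k = {u \<in> carrier E. dot u (\<eta> k) = 0}"

definition D :: "((nat \<Rightarrow> int) \<times> int) set" where
  "D = {(u, k). k \<in> carrier K - {\<one>\<^bsub>K\<^esub>} \<and> u \<in> hyperplane k}"

definition \<theta> :: "(nat \<Rightarrow> int) \<times> int \<Rightarrow> (nat \<Rightarrow> int) \<times> int" where
  "\<theta> = map_prod shear \<alpha>"

text \<open>The exponent of \<open>(u, k)\<close> is the coordinate \<open>u 0\<close>, which is additive and invariant under \<open>shear\<close>; this gives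
the functional equation of a gamma function.\<close>
definition \<phi> :: "(nat \<Rightarrow> int) \<times> int \<Rightarrow> (nat \<Rightarrow> int) \<times> int \<Rightarrow> (nat \<Rightarrow> int) \<times> int" where
  "\<phi> z = \<theta> ^^ nat (fst z 0)"

definition G :: "((nat \<Rightarrow> int) \<times> int) monoid" where
  "G = twisted_group (E \<times>\<times> K) \<phi>"

text \<open>The number of hyperplanes through a nonzero vector.\<close>
definition \<nu> :: nat where "\<nu> = (q ^ s - 1) div (q - 1)"

lemma \<nu>: "(q - 1) * \<nu> = q ^ s - 1"
proof -
  have "\<nu> = (\<Sum>i<s. q ^ i)"
    unfolding \<nu>_def geometric_sum_nat[OF q_pos, symmetric] using q_gt_1 by simp
  then show ?thesis using geometric_sum_nat[OF q_pos, of s] by simp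
qed

lemma M_eq: "M = q * \<nu> + 2"
proof -
  have "q ^ s \<ge> 1" using q_pos by simp
  have "(q - 1) * (M - 1) = q * (q ^ s - 1) + (q - 1)"
    using M \<open>q ^ s \<ge> 1\<close> q_gt_1 by (simp add: algebra_simps)
  also have "\<dots> = (q - 1) * (q * \<nu> + 1)"
    using \<nu> by (simp add: algebra_simps)
  finally have "(q - 1) * (M - 1) = (q - 1) * (q * \<nu> + 1)" .
  moreover have "q - 1 \<noteq> 0" using q_gt_1 by simp
  ultimately have "M - 1 = q * \<nu> + 1" by (metis mult_cancel_left)
  then show ?thesis by simp
qed

lemma M_gt_1: "M > 1" using M_eq by simp

lemma carrier_K: "carrier K = {0..<int M}"
  using M_gt_1 by (simp add: K_def carrier_integer_mod_group)

lemma mult_K: "x \<otimes>\<^bsub>K\<^esub> y = (x + y) mod int M" by (simp add: K_def)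

lemma one_K: "\<one>\<^bsub>K\<^esub> = 0" by (simp add: K_def)

lemma group_K: "group K" by (simp add: K_def)

lemma order_K: "order K = M" by (simp add: order_def carrier_K)

lemma group_EK: "group (E \<times>\<times> K)"
  using group_E group_K by (rule DirProd_group)

lemma group_hom_dot: "group_hom E (integer_mod_group q) (\<lambda>u. dot u w)"
  using dot_hom group_E by (simp add: group_hom_def group_hom_axioms_def)

lemma \<eta>_inj: "inj_on \<eta> (carrier K - {\<one>\<^bsub>K\<^esub>})"
  using bij_betw_imp_inj_on[OF \<eta>_bij] by (simp add: carrier_K one_K)

lemma \<eta>_image: "normalized = \<eta> ` (carrier K - {\<one>\<^bsub>K\<^esub>})"
  using bij_betw_imp_surj_on[OF \<eta>_bij] by (simp add: carrier_K one_K)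

lemma \<eta>_normalized: "k \<in> carrier K - {\<one>\<^bsub>K\<^esub>} \<Longrightarrow> \<eta> k \<in> normalized"
  unfolding \<eta>_image by (rule imageI)

lemma difference_set_D:
  "difference_set (E \<times>\<times> K) D (q ^ (s + 1) * M) ((M - 1) * q ^ s) (q ^ s * \<nu>)"
proof -
  have "difference_set (E \<times>\<times> K) D (order E * order K) ((order K - 1) * q ^ s) (\<nu> * q ^ s)"
    unfolding D_def
  proof (rule difference_set_DirProd_subgroups[where m = "q ^ (s - 1)" and n = \<nu>])
    fix k assume k: "k \<in> carrier K - {\<one>\<^bsub>K\<^esub>}"
    have "hyperplane k = kernel E (integer_mod_group q) (\<lambda>u. dot u (\<eta> k))"
      by (simp add: hyperplane_def kernel_def)
    then show "subgroup (hyperplane k) E"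
      using group_hom.subgroup_kernel[OF group_hom_dot] by simp
    show "card (hyperplane k) = q ^ s"
      using card_dot_fiber[of "\<eta> k" 0] \<eta>_normalized[OF k] normalized_in_E normalized_ne_one
      by (simp add: hyperplane_def)
  next
    fix k k' g
    assume k: "k \<in> carrier K - {\<one>\<^bsub>K\<^esub>}" and k': "k' \<in> carrier K - {\<one>\<^bsub>K\<^esub>}"
      and ne: "k \<noteq> k'" and g: "g \<in> carrier E"
    let ?c = "(- dot g (\<eta> k')) mod int q"
    have "g \<otimes>\<^bsub>E\<^esub> u \<in> hyperplane k' \<longleftrightarrow> dot u (\<eta> k') = ?c" if u: "u \<in> carrier E" for u
    proof -
      have "g \<otimes>\<^bsub>E\<^esub> u \<in> hyperplane k' \<longleftrightarrow> (dot g (\<eta> k') + dot u (\<eta> k')) mod int q = 0"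
        using u g group_E by (simp add: hyperplane_def dot_mult group.is_monoid monoid.m_closed)
      also have "\<dots> \<longleftrightarrow> dot u (\<eta> k') mod int q = ?c"
        by (simp add: mod_eq_dvd_iff dvd_eq_mod_eq_0[symmetric] add.commute)
      also have "dot u (\<eta> k') mod int q = dot u (\<eta> k')" by (simp add: dot_def)
      finally show ?thesis .
    qed
    then have "{u \<in> hyperplane k. g \<otimes>\<^bsub>E\<^esub> u \<in> hyperplane k'} =
      {u \<in> carrier E. dot u (\<eta> k) = 0 \<and> dot u (\<eta> k') = ?c}"
      by (auto simp: hyperplane_def[of k])
    moreover have "\<eta> k \<noteq> \<eta> k'"
      using inj_onD[OF \<eta>_inj _ k k'] ne by blast
    then have "card {u \<in> carrier E. dot u (\<eta> k) = 0 \<and> dot u (\<eta> k') = ?c} * q ^ 2 = q ^ (s + 1)"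
      using \<eta>_normalized k k' q_pos
      by (intro card_two_dot_fibers) (auto simp: carrier_integer_mod_group)
    moreover have "q ^ (s + 1) = q ^ (s - 1) * q ^ 2"
      using s_ge_2 by (simp flip: power_add)
    ultimately show "card {u \<in> hyperplane k. g \<otimes>\<^bsub>E\<^esub> u \<in> hyperplane k'} = q ^ (s - 1)"
      using q_pos by simp
  next
    fix g assume g: "g \<in> carrier E - {\<one>\<^bsub>E\<^esub>}"
    have "{w \<in> normalized. dot g w = 0} = \<eta> ` {k \<in> carrier K - {\<one>\<^bsub>K\<^esub>}. g \<in> hyperplane k}"
      using g unfolding \<eta>_image by (auto simp: hyperplane_def)
    moreover have "inj_on \<eta> {k \<in> carrier K - {\<one>\<^bsub>K\<^esub>}. g \<in> hyperplane k}"
      using \<eta>_inj by (rule inj_on_subset) blast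
    ultimately have "card {k \<in> carrier K - {\<one>\<^bsub>K\<^esub>}. g \<in> hyperplane k} = card {w \<in> normalized. dot g w = 0}"
      by (simp add: card_image)
    moreover have "(q - 1) * card {w \<in> normalized. dot g w = 0} = (q - 1) * \<nu>"
      using card_normalized_orthogonal g \<nu> by simp
    ultimately show "card {k \<in> carrier K - {\<one>\<^bsub>K\<^esub>}. g \<in> hyperplane k} = \<nu>"
      using q_gt_1 by simp
  next
    have "q * q ^ (s - 1) = q ^ s" using s_ge_2 by (simp flip: power_Suc)
    moreover have "order K - 2 = q * \<nu>" unfolding order_K by (simp add: M_eq)
    ultimately show "(order K - 2) * q ^ (s - 1) = \<nu> * q ^ s"
      by (metis mult.assoc mult.commute)
  qed (use group_E finite_E group_K carrier_K in simp_all)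
  then show ?thesis by (simp add: order_E order_K mult.commute)
qed

lemma \<alpha>_in_K: "\<alpha> k \<in> carrier K"
  using M_gt_1 by (simp add: \<alpha>_def carrier_K)

lemma \<alpha>_mult: "\<alpha> (k \<otimes>\<^bsub>K\<^esub> l) = \<alpha> k \<otimes>\<^bsub>K\<^esub> \<alpha> l"
  by (simp add: \<alpha>_def mult_K mod_simps distrib_left)

lemma \<alpha>_funpow_q: "k \<in> carrier K \<Longrightarrow> (\<alpha> ^^ q) k = k"
  unfolding \<alpha>_def[abs_def] carrier_K by (rule funpow_mult_mod_period[OF a_power])

lemma \<theta>_funpow: "(\<theta> ^^ m) (u, k) = ((shear ^^ m) u, (\<alpha> ^^ m) k)"
  by (induction m) (simp_all add: \<theta>_def)

lemma \<theta>_funpow_q: "z \<in> carrier (E \<times>\<times> K) \<Longrightarrow> (\<theta> ^^ q) z = z"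
  using shear_funpow_q[OF s_less_q] \<alpha>_funpow_q by (auto simp: \<theta>_funpow)

lemma \<theta>_closed: "\<theta> ` carrier (E \<times>\<times> K) \<subseteq> carrier (E \<times>\<times> K)"
  using shear_in_E \<alpha>_in_K by (auto simp: \<theta>_def)

lemma \<theta>_bij: "bij_betw \<theta> (carrier (E \<times>\<times> K)) (carrier (E \<times>\<times> K))"
  by (rule bij_betw_if_funpow_id[OF \<theta>_closed \<theta>_funpow_q q_pos])

lemma \<theta>_iso: "\<theta> \<in> iso (E \<times>\<times> K) (E \<times>\<times> K)"
proof -
  have "\<theta> \<in> hom (E \<times>\<times> K) (E \<times>\<times> K)"
    using \<theta>_closed by (auto simp: hom_def \<theta>_def shear_mult \<alpha>_mult)
  then show ?thesis using \<theta>_bij by (simp add: iso_def)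
qed

text \<open>A point \<open>(u, k)\<close> of \<open>D\<close> goes to \<open>(shear u, a * k)\<close>, and adjointness together with the equivariance of \<open>\<eta>\<close>
moves \<open>shear\<close> from the vector to the label.\<close>
lemma \<theta>_D: "\<theta> ` D = D"
proof (rule endo_inj_surj)
  have sub: "D \<subseteq> carrier (E \<times>\<times> K)" and fin: "finite (carrier (E \<times>\<times> K))"
    using difference_set_D by (simp_all add: difference_set_iff)
  show "finite D" using sub fin by (rule finite_subset)
  show "inj_on \<theta> D" using \<theta>_bij sub by (auto simp: bij_betw_def intro: inj_on_subset)
  show "\<theta> ` D \<subseteq> D"
  proof (rule image_subsetI)
    fix z assume z: "z \<in> D"
    obtain u k where zuk: "z = (u, k)" by (metis surj_pair)
    then have k: "k \<in> carrier K" "k \<noteq> 0" and u: "u \<in> carrier E" "dot u (\<eta> k) = 0"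
      using z by (auto simp: D_def hyperplane_def one_K)
    have "\<alpha> k \<noteq> 0"
      using mult_mod_ne_0[OF a_power q_pos] k by (simp add: \<alpha>_def carrier_K)
    moreover have "dot (shear u) (\<eta> (\<alpha> k)) = 0"
      using \<eta>_equivariant[of k] k u by (simp add: dot_shear \<alpha>_def carrier_K)
    ultimately show "\<theta> z \<in> D"
      using \<alpha>_in_K shear_in_E by (simp add: zuk \<theta>_def D_def hyperplane_def one_K)
  qed
qed

lemma shear_funpow_0: "u \<in> carrier E \<Longrightarrow> (shear ^^ m) u 0 = u 0"
  by (induction m) (simp_all add: shear_0 shear_funpow_in_E)

lemma gamma_function_\<phi>: "gamma_function (E \<times>\<times> K) \<phi>"
proof -
  have additive: "[nat (fst (x \<otimes>\<^bsub>E \<times>\<times> K\<^esub> (\<theta> ^^ nat (fst x 0)) y) 0) = nat (fst x 0) + nat (fst y 0)] (mod q)"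
    if xy: "x \<in> carrier (E \<times>\<times> K)" "y \<in> carrier (E \<times>\<times> K)" for x y
  proof -
    obtain u k v l where x: "x = (u, k)" and y: "y = (v, l)" by (metis surj_pair)
    have "u \<in> carrier E" "v \<in> carrier E" using xy x y by auto
    then have "fst (x \<otimes>\<^bsub>E \<times>\<times> K\<^esub> (\<theta> ^^ nat (fst x 0)) y) 0 = (u 0 + v 0) mod int q" "u 0 \<ge> 0" "v 0 \<ge> 0"
      by (simp_all add: x y \<theta>_funpow mult_E vec_nth shear_funpow_0 mem_E)
    then show ?thesis by (simp add: x y cong_def nat_mod_distrib nat_add_distrib)
  qed
  show ?thesis
    unfolding \<phi>_def[abs_def]
    by (rule group.gamma_function_funpow[OF group_EK \<theta>_iso \<theta>_funpow_q additive])
qed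

lemma group_G: "group G" unfolding G_def using gamma_function_\<phi> by (rule gamma_function.group_twisted)

lemma difference_set_G: "difference_set G D (q ^ (s + 1) * M) ((M - 1) * q ^ s) (q ^ s * \<nu>)"
  unfolding G_def
proof (rule gamma_function.difference_set_twisted[OF gamma_function_\<phi> difference_set_D])
  have "(\<theta> ^^ m) ` D = D" for m
    by (induction m) (simp, simp only: funpow.simps image_comp[symmetric] \<theta>_D)
  then show "\<phi> z ` D = D" for z by (simp add: \<phi>_def)
qed

lemma carrier_G: "carrier G = carrier E \<times> carrier K"
  by (simp add: G_def twisted_group_def)

lemma one_G: "\<one>\<^bsub>G\<^esub> = (\<one>\<^bsub>E\<^esub>, 0)"
  by (simp add: G_def twisted_group_def one_K)

lemma mult_G: "(u, k) \<otimes>\<^bsub>G\<^esub> (v, l) =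
    (u \<otimes>\<^bsub>E\<^esub> (shear ^^ nat (u 0)) v, (k + (\<alpha> ^^ nat (u 0)) l) mod int M)"
  by (simp add: G_def twisted_group_def \<phi>_def \<theta>_funpow mult_K)

definition Q :: "((nat \<Rightarrow> int) \<times> int) set" where "Q = carrier E \<times> {0}"

lemma \<alpha>_funpow_0: "(\<alpha> ^^ m) 0 = 0"
  by (induction m) (simp_all add: \<alpha>_def)

lemma subgroup_Q: "subgroup Q G"
proof (rule group.subgroupI[OF group_G])
  interpret G: group G by (rule group_G)
  interpret E: group E by (rule group_E)
  show sub: "Q \<subseteq> carrier G" using M_gt_1 by (auto simp: Q_def carrier_G carrier_K)
  show "Q \<noteq> {}" using E.one_closed by (auto simp: Q_def)
  show "x \<otimes>\<^bsub>G\<^esub> y \<in> Q" if "x \<in> Q" "y \<in> Q" for x y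
    using that shear_funpow_in_E by (auto simp: Q_def mult_G \<alpha>_funpow_0)
  show "inv\<^bsub>G\<^esub> x \<in> Q" if x: "x \<in> Q" for x
  proof -
    obtain u where u: "x = (u, 0)" using x by (auto simp: Q_def)
    obtain v l where v: "inv\<^bsub>G\<^esub> x = (v, l)" by (metis surj_pair)
    have xG: "x \<in> carrier G" using x sub by blast
    have "(v, l) \<in> carrier G" using G.inv_closed[OF xG] by (simp only: v)
    moreover have "(v, l) \<otimes>\<^bsub>G\<^esub> (u, 0) = \<one>\<^bsub>G\<^esub>" using G.l_inv[OF xG] by (simp only: v flip: u)
    ultimately have "l = 0" "v \<in> carrier E"
      by (auto simp: mult_G one_G \<alpha>_funpow_0 carrier_G carrier_K)
    then show ?thesis by (simp add: v Q_def)
  qed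
qed

text \<open>Since \<open>M = q * \<nu> + 2\<close> and \<open>q > 2\<close>, the factor \<open>M\<close> of the group order is prime to \<open>q\<close>.\<close>
lemma sylow_Q: "sylow_subgroup q G Q"
proof -
  have order: "order G = q ^ (s + 1) * M"
    using difference_set_G by (simp add: difference_set_iff)
  have "\<not> q dvd M"
  proof
    assume "q dvd M"
    then have "q dvd 2" unfolding M_eq by (simp only: dvd_add_right_iff[OF dvd_triv_left])
    then have "q \<le> 2" by (rule dvd_imp_le) simp
    then show False using s_ge_2 s_less_q by simp
  qed
  then have "multiplicity q (order G) = s + 1"
    using q_pos unfolding order by (intro multiplicity_eqI) auto
  moreover have "card Q = q ^ (s + 1)"
    using order_E by (simp add: Q_def card_cartesian_product order_def)
  ultimately show ?thesis
    using prime group_G subgroup_Q difference_set_G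
    by (simp add: sylow_subgroup_def difference_set_iff)
qed

definition unit_vec :: "nat \<Rightarrow> nat \<Rightarrow> int" where "unit_vec i = vec (\<lambda>j. if j = i then 1 else 0)"

lemma unit_vec_in_E: "unit_vec i \<in> carrier E" unfolding unit_vec_def by (rule vec_in_E)

lemma unit_vec_nth: "j \<le> s \<Longrightarrow> unit_vec i j = (if j = i then 1 else 0)"
  using q_gt_1 by (simp add: unit_vec_def vec_nth)

text \<open>The unit vector with index \<open>0\<close> has exponent \<open>1\<close> and shears the one with index \<open>1\<close>, which has exponent \<open>0\<close>
and does nothing in return; the products differ in coordinate \<open>2 \<le> s\<close>.\<close>
lemma not_comm_Q: "\<not> comm_group (G\<lparr>carrier := Q\<rparr>)"
proof
  assume "comm_group (G\<lparr>carrier := Q\<rparr>)"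
  then interpret Q: comm_group "G\<lparr>carrier := Q\<rparr>" .
  have "(unit_vec 0, 0) \<otimes>\<^bsub>G\<^esub> (unit_vec 1, 0) = (unit_vec 1, 0) \<otimes>\<^bsub>G\<^esub> (unit_vec 0, 0)"
    using Q.m_comm[of "(unit_vec 0, 0)" "(unit_vec 1, 0)"] unit_vec_in_E by (simp add: Q_def)
  then have "unit_vec 0 \<otimes>\<^bsub>E\<^esub> shear (unit_vec 1) = unit_vec 1 \<otimes>\<^bsub>E\<^esub> unit_vec 0"
    using s_ge_2 by (simp add: mult_G unit_vec_nth)
  from fun_cong[OF this, of 2] show False
    using s_ge_2 q_gt_1 by (simp add: mult_E shear_def vec_nth unit_vec_nth)
qed

text \<open>If the conjugate of the unit vector with index \<open>0\<close> by \<open>(0, 1)\<close> were some \<open>(v, 0)\<close>, comparing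
\<open>(0, 1) \<circ> (unit_vec 0, 0) = (unit_vec 0, 1)\<close> with \<open>(v, 0) \<circ> (0, 1)\<close> would give \<open>v = unit_vec 0\<close> and
\<open>a * 1 = 1\<close> modulo \<open>M\<close>.\<close>
lemma not_normal_Q: "\<not> Q \<lhd> G"
proof
  assume "Q \<lhd> G"
  then interpret Q: normal Q G .
  interpret E: group E by (rule group_E)
  have one: "(\<one>\<^bsub>E\<^esub>, 1) \<in> carrier G" using M_gt_1 by (simp add: carrier_G carrier_K)
  have unitQ: "(unit_vec 0, 0) \<in> Q" by (simp add: Q_def unit_vec_in_E)
  then have unitG: "(unit_vec 0, 0) \<in> carrier G" using Q.subset by blast
  have "(\<one>\<^bsub>E\<^esub>, 1) \<otimes>\<^bsub>G\<^esub> (unit_vec 0, 0) \<otimes>\<^bsub>G\<^esub> inv\<^bsub>G\<^esub> (\<one>\<^bsub>E\<^esub>, 1) \<in> Q"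
    using one unitQ by (rule Q.inv_op_closed2)
  then obtain v where v: "v \<in> carrier E"
    "(\<one>\<^bsub>E\<^esub>, 1) \<otimes>\<^bsub>G\<^esub> (unit_vec 0, 0) \<otimes>\<^bsub>G\<^esub> inv\<^bsub>G\<^esub> (\<one>\<^bsub>E\<^esub>, 1) = (v, 0)"
    by (auto simp: Q_def)
  have "(v, 0) \<in> carrier G" using v(1) M_gt_1 by (simp add: carrier_G carrier_K)
  then have "(\<one>\<^bsub>E\<^esub>, 1) \<otimes>\<^bsub>G\<^esub> (unit_vec 0, 0) = (v, 0) \<otimes>\<^bsub>G\<^esub> (\<one>\<^bsub>E\<^esub>, 1)"
    using v(2) one unitG by (metis Q.inv_solve_right Q.m_closed)
  moreover have "\<one>\<^bsub>E\<^esub> 0 = 0" by (simp add: one_E vec_nth)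
  moreover have "(shear ^^ m) \<one>\<^bsub>E\<^esub> = \<one>\<^bsub>E\<^esub>" for m
  proof (induction m)
    case (Suc m)
    have "shear \<one>\<^bsub>E\<^esub> = \<one>\<^bsub>E\<^esub>"
      unfolding one_E by (rule vec_eqI[OF shear_in_E vec_in_E]) (simp add: shear_def vec_nth)
    then show ?case using Suc by simp
  qed simp
  ultimately have unit_v: "unit_vec 0 = v" and twist: "1 = (\<alpha> ^^ nat (v 0)) 1 mod int M"
    using v(1) unit_vec_in_E M_gt_1 by (simp_all add: mult_G)
  have "v 0 = 1" unfolding unit_v[symmetric] by (simp add: unit_vec_nth)
  with twist have "1 = int a mod int M" by (simp add: \<alpha>_def)
  then have "[int a = int 1] (mod int M)" using M_gt_1 by (simp add: cong_def)
  then show False using a_ne_1 by (simp only: cong_int_iff)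
qed

end

section \<open>Transport along isomorphisms\<close>

lemma difference_set_iso:
  assumes "\<psi> \<in> iso G G'" "group G'" "difference_set G D v k l"
  shows "difference_set G' (\<psi> ` D) v k l"
proof -
  interpret G: group G using assms by (simp add: difference_set_iff)
  interpret G': group G' by fact
  interpret group_hom G G' \<psi> using assms(1) by unfold_locales (simp add: iso_def)
  have bij: "bij_betw \<psi> (carrier G) (carrier G')" using assms(1) by (simp add: iso_def)
  have D: "D \<subseteq> carrier G" using assms(3) by (simp add: difference_set_iff)
  have inj: "inj_on \<psi> D" using bij D by (auto simp: bij_betw_def intro: inj_on_subset)
  have mem: "\<psi> x \<in> \<psi> ` D \<longleftrightarrow> x \<in> D" if "x \<in> carrier G" for x
    using bij D that by (intro inj_on_image_mem_iff[of \<psi> "carrier G"]) (auto simp: bij_betw_def)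
  have "card {d \<in> \<psi> ` D. g \<otimes>\<^bsub>G'\<^esub> d \<in> \<psi> ` D} = l" if g: "g \<in> carrier G' - {\<one>\<^bsub>G'\<^esub>}" for g
  proof -
    have "g \<in> \<psi> ` carrier G" using bij g by (simp add: bij_betw_def)
    then obtain a where a: "a \<in> carrier G" "\<psi> a = g" by blast
    have "{d \<in> \<psi> ` D. g \<otimes>\<^bsub>G'\<^esub> d \<in> \<psi> ` D} = \<psi> ` {d \<in> D. a \<otimes>\<^bsub>G\<^esub> d \<in> D}"
    proof -
      have "g \<otimes>\<^bsub>G'\<^esub> \<psi> d \<in> \<psi> ` D \<longleftrightarrow> a \<otimes>\<^bsub>G\<^esub> d \<in> D" if "d \<in> D" for d
        using that D a mem[of "a \<otimes>\<^bsub>G\<^esub> d"] by (auto simp flip: hom_mult)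
      then show ?thesis by auto
    qed
    moreover have "card (\<psi> ` {d \<in> D. a \<otimes>\<^bsub>G\<^esub> d \<in> D}) = card {d \<in> D. a \<otimes>\<^bsub>G\<^esub> d \<in> D}"
      using inj by (intro card_image) (auto intro: inj_on_subset)
    moreover have "a \<noteq> \<one>\<^bsub>G\<^esub>" using a g by auto
    ultimately show ?thesis using assms(3) a by (simp add: difference_set_iff)
  qed
  moreover have "\<psi> ` D \<subseteq> carrier G'" "finite (carrier G')" "order G' = order G"
    using bij D assms(3) bij_betw_finite[OF bij] bij_betw_same_card[OF bij]
    by (auto simp: bij_betw_def difference_set_iff order_def)
  ultimately show ?thesis
    using assms(3) G'.group_axioms card_image[OF inj] by (simp add: difference_set_iff)
qed

lemma finite_group_iso_nat:
  assumes "group (G :: ('a, 'b) monoid_scheme)" "finite (carrier G)"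
  obtains G' :: "nat monoid" and \<psi> where "group G'" "\<psi> \<in> iso G G'"
proof -
  interpret group G by fact
  obtain \<psi> :: "'a \<Rightarrow> nat" where \<psi>: "inj_on \<psi> (carrier G)"
    using finite_imp_inj_to_nat_seg[OF assms(2)] by blast
  define \<chi> where "\<chi> = inv_into (carrier G) \<psi>"
  have \<chi>[simp]: "\<chi> (\<psi> x) = x" if "x \<in> carrier G" for x using that \<psi> by (simp add: \<chi>_def)
  define G' :: "nat monoid" where
    "G' = \<lparr>carrier = \<psi> ` carrier G, monoid.mult = (\<lambda>x y. \<psi> (\<chi> x \<otimes>\<^bsub>G\<^esub> \<chi> y)), one = \<psi> \<one>\<^bsub>G\<^esub>\<rparr>"
  have "group G'"
  proof (rule groupI)
    fix x assume "x \<in> carrier G'"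
    then obtain a where "a \<in> carrier G" "x = \<psi> a" by (auto simp: G'_def)
    then show "\<exists>y\<in>carrier G'. y \<otimes>\<^bsub>G'\<^esub> x = \<one>\<^bsub>G'\<^esub>"
      by (intro bexI[of _ "\<psi> (inv\<^bsub>G\<^esub> a)"]) (auto simp: G'_def)
  qed (auto simp: G'_def m_assoc)
  moreover have "\<psi> \<in> iso G G'"
    using \<psi> by (auto simp: iso_def hom_def G'_def bij_betw_def)
  ultimately show thesis by (rule that)
qed

lemma sylow_subgroup_iso:
  assumes "\<psi> \<in> iso G G'" "group G'" "sylow_subgroup q G Q"
  shows "sylow_subgroup q G' (\<psi> ` Q)"
proof -
  interpret group_hom G G' \<psi>
    using assms by (simp add: group_hom_def group_hom_axioms_def iso_def sylow_subgroup_def)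
  have bij: "bij_betw \<psi> (carrier G) (carrier G')" using assms(1) by (simp add: iso_def)
  have Q: "subgroup Q G" using assms(3) by (simp add: sylow_subgroup_def)
  have "inj_on \<psi> Q" using bij subgroup.subset[OF Q] by (auto simp: bij_betw_def intro: inj_on_subset)
  then show ?thesis
    using assms Q subgroup_img_is_subgroup[OF Q] bij_betw_finite[OF bij] bij_betw_same_card[OF bij]
    by (simp add: sylow_subgroup_def card_image order_def)
qed

lemma normal_if_iso_image_normal:
  assumes "\<psi> \<in> iso G G'" "group G" "group G'" "Q \<subseteq> carrier G" "\<psi> ` Q \<lhd> G'"
  shows "Q \<lhd> G"
proof -
  have "inv_into (carrier G) \<psi> ` (\<psi> ` Q) \<lhd> G"
    using group.iso_set_sym[OF assms(2,1)] assms(3,2,5) by (rule iso_normal_subgroup)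
  moreover have "inj_on \<psi> (carrier G)" using assms(1) by (simp add: iso_def bij_betw_def)
  ultimately show ?thesis using assms(4) by (simp add: inv_into_image_cancel)
qed

lemma comm_group_if_iso_image_comm_group:
  assumes "\<psi> \<in> iso G G'" "group G" "group G'" "subgroup Q G" "comm_group (G'\<lparr>carrier := \<psi> ` Q\<rparr>)"
  shows "comm_group (G\<lparr>carrier := Q\<rparr>)"
proof -
  have "restrict \<psi> Q \<in> iso (G\<lparr>carrier := Q\<rparr>) (G'\<lparr>carrier := \<psi> ` Q\<rparr>)"
    using assms(1-4) by (rule iso_restrict)
  moreover have "group (G\<lparr>carrier := Q\<rparr>)" using assms(4,2) by (rule subgroup.subgroup_is_group)
  ultimately have "G'\<lparr>carrier := \<psi> ` Q\<rparr> \<cong> G\<lparr>carrier := Q\<rparr>" "monoid (G\<lparr>carrier := Q\<rparr>)"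
    using group.iso_sym by (auto simp: is_iso_def group_def)
  then show ?thesis using assms(5) by (simp add: comm_group.iso_imp_comm_group)
qed

section \<open>Existence\<close>

theorem theorem7p10:
  fixes q s p r :: nat
  assumes "Factorial_Ring.prime q" and "odd q"
    and "2 \<le> s" and "s < q"
    and "r = (q ^ (s + 1) - 1) div (q - 1)"
    and "r + 1 = 2 * p"
    and "Factorial_Ring.prime p" and "odd p"
  shows "\<exists>(G :: nat monoid) Q D.
    group G \<and> finite (carrier G) \<and>
    sylow_subgroup q G Q \<and> \<not> Q \<lhd> G \<and> \<not> comm_group (G\<lparr>carrier := Q\<rparr>) \<and>
    difference_set G D
      (q ^ (s + 1) * ((q ^ (s + 1) - 1) div (q - 1) + 1))
      (q ^ s * ((q ^ (s + 1) - 1) div (q - 1)))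
      (q ^ s * ((q ^ s - 1) div (q - 1)))"
proof -
  interpret V: residue_vectors q s using assms(1) by unfold_locales
  have r: "(q - 1) * r = q ^ (s + 1) - 1" "card V.normalized = r"
  proof -
    have "card V.normalized = r"
      unfolding assms(5) V.card_all_normalized[symmetric] using V.q_gt_1 by simp
    then show "(q - 1) * r = q ^ (s + 1) - 1" "card V.normalized = r"
      using V.card_all_normalized by simp_all
  qed
  \<comment> \<open>From \<open>2 * p = 2 + q + ... + q ^ s\<close>.\<close>
  have "q dvd p - 1"
  proof -
    have "r = (\<Sum>i<s + 1. q ^ i)"
      unfolding assms(5) geometric_sum_nat[OF V.q_pos, symmetric] using V.q_gt_1 by simp
    then have "r = 1 + q * (\<Sum>i<s. q ^ i)"
      by (simp add: sum.lessThan_Suc_shift sum_distrib_left del: sum.lessThan_Suc)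
    then have "2 * (p - 1) = q * (\<Sum>i<s. q ^ i)" using assms(6) by simp
    then have "q dvd 2 * (p - 1)" by simp
    then show ?thesis using assms(1,2) by (simp add: coprime_dvd_mult_right_iff)
  qed
  then obtain a where a: "odd a" "[a ^ q = 1] (mod p)" "\<not> [a = 1] (mod p)"
    using odd_element_of_prime_order[OF assms(7,1,8)] by blast
  let ?N = "{0..<int (2 * p)} - {0}"
  let ?f = "\<lambda>k. int a * k mod int (2 * p)"
  have p: "p > 1" using assms(7) by (rule prime_gt_1_nat)
  have a_power: "[a ^ q = 1] (mod 2 * p)"
  proof (rule coprime_cong_mult_nat)
    have "odd (a ^ q)" using a(1) by simp
    then show "[a ^ q = 1] (mod 2)" by (simp only: cong_def odd_iff_mod_2_eq_one) simp
  qed (use a assms(8) in simp_all)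
  have f_period: "(?f ^^ q) k = k" if k: "k \<in> ?N" for k
    by (rule funpow_mult_mod_period[OF a_power]) (use k in simp)
  have f_closed: "?f ` ?N \<subseteq> ?N"
  proof (rule image_subsetI)
    fix k assume "k \<in> ?N"
    then have "?f k \<noteq> 0" by (intro mult_mod_ne_0[OF a_power V.q_pos]) simp_all
    then show "?f k \<in> ?N" using p by simp
  qed
  \<comment> \<open>Because \<open>a\<close> is odd and \<open>a - 1\<close> is prime to \<open>p\<close>, \<open>2 * p\<close> divides \<open>(a - 1) * k\<close> exactly when \<open>p\<close> divides \<open>k\<close>.\<close>
  have f_fixed: "{k \<in> ?N. ?f k = k} = {int p}"
  proof (intro equalityI subsetI)
    fix k assume "k \<in> {k \<in> ?N. ?f k = k}"
    then have k: "0 < k" "k < 2 * int p" "?f k = k" by auto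
    then have "int (2 * p) dvd int a * k - k" by (metis mod_mod_trivial mod_eq_dvd_iff)
    then have "int (2 * p) dvd (int a - 1) * k" by (simp add: algebra_simps)
    then have "int p dvd (int a - 1) * k" by (metis dvd_mult_left of_nat_mult mult.commute)
    moreover have "\<not> int p dvd int a - 1"
      using a(3) by (simp add: cong_int_iff[symmetric] cong_iff_dvd_diff)
    ultimately have "int p dvd k" using assms(7) by (simp add: prime_dvd_mult_iff)
    then obtain c where "k = int p * c" by (elim dvdE)
    moreover from this have "0 < c" "c < 2" using k p
      by (auto simp: zero_less_mult_iff)
    ultimately show "k \<in> {int p}" by simp
  next
    fix k assume "k \<in> {int p}"
    moreover obtain b where "a = 2 * b + 1" using a(1) by (elim oddE)
    then have "int a * int p = int p + int b * int (2 * p)" by (simp add: algebra_simps)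
    then have "?f (int p) = int p" using p by (simp del: of_nat_mult)
    ultimately show "k \<in> {k \<in> ?N. ?f k = k}" using p by simp
  qed
  \<comment> \<open>The inverse of \<open>coshear\<close>: a labelling equivariant for it satisfies \<open>coshear (\<eta> (a * k)) = \<eta> k\<close>.\<close>
  let ?g = "V.coshear ^^ (q - 1)"
  have co_period: "(V.coshear ^^ q) w = w" if "w \<in> V.normalized" for w
    using V.coshear_funpow_q[OF assms(4)] V.normalized_in_E that by blast
  have co_g: "V.coshear (?g w) = w" if "w \<in> V.normalized" for w
    using co_period[OF that] V.q_pos by (metis Suc_diff_1 comp_apply funpow.simps(2))
  have g_closed: "?g ` V.normalized \<subseteq> V.normalized"
    using funpow_closed[OF V.coshear_normalized] by blast
  have g_period: "(?g ^^ q) w = w" if w: "w \<in> V.normalized" for w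
  proof -
    have "((V.coshear ^^ q) ^^ m) w = w" for m
      by (induction m) (simp_all add: co_period[OF w])
    from this[of "q - 1"] show ?thesis by (simp only: funpow_mult mult.commute)
  qed
  have g_fixed: "{w \<in> V.normalized. ?g w = w} = {w \<in> V.normalized. V.coshear w = w}"
  proof -
    have "(V.coshear ^^ m) w = w" if "V.coshear w = w" for m w
      using that by (induction m) simp_all
    then show ?thesis using co_g by force
  qed
  have fin: "finite V.normalized"
    using V.finite_E V.normalized_in_E by (meson finite_subset subsetI)
  have "card ?N = card V.normalized" using r(2) assms(6) p by simp
  moreover have "card {k \<in> ?N. ?f k = k} = card {w \<in> V.normalized. ?g w = w}"
    unfolding f_fixed g_fixed V.coshear_fixed by simp
  ultimately obtain \<eta> where \<eta>: "bij_betw \<eta> ?N V.normalized"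
    "\<And>k. k \<in> ?N \<Longrightarrow> \<eta> (?f k) = ?g (\<eta> k)"
    using equivariant_bij[OF assms(1) _ fin _ f_closed f_period g_closed g_period] by auto
  interpret L: equivariant_labelling q s "2 * p" a \<eta>
  proof
    show "(q - 1) * (2 * p - 1) = q ^ (s + 1) - 1" using r(1) assms(6) by (metis add_diff_cancel_right')
    show "\<not> [a = 1] (mod 2 * p)" using a(3) cong_modulus_mult_nat by (metis mult.commute)
    show "V.coshear (\<eta> (?f k)) = \<eta> k" if "k \<in> ?N" for k
      using \<eta> co_g that bij_betwE by metis
  qed (use assms a_power \<eta> in auto)
  obtain G' :: "nat monoid" and \<psi> where G': "group G'" and \<psi>: "\<psi> \<in> iso L.G G'"
    using finite_group_iso_nat L.group_G L.difference_set_G unfolding difference_set_iff by metis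
  have "difference_set G' (\<psi> ` L.D) (q ^ (s + 1) * (2 * p)) ((2 * p - 1) * q ^ s) (q ^ s * L.\<nu>)"
    using \<psi> G' L.difference_set_G by (rule difference_set_iso)
  moreover have "2 * p - 1 = r" using assms(6) by simp
  ultimately have "difference_set G' (\<psi> ` L.D) (q ^ (s + 1) * (r + 1)) (q ^ s * r) (q ^ s * L.\<nu>)"
    by (simp only: assms(6) mult.commute)
  note D = this[unfolded L.\<nu>_def assms(5)]
  have "sylow_subgroup q G' (\<psi> ` L.Q)"
    using \<psi> G' L.sylow_Q by (rule sylow_subgroup_iso)
  moreover have "\<not> \<psi> ` L.Q \<lhd> G'"
    using normal_if_iso_image_normal[OF \<psi> L.group_G G'] L.not_normal_Q subgroup.subset[OF L.subgroup_Q] by blast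
  moreover have "\<not> comm_group (G'\<lparr>carrier := \<psi> ` L.Q\<rparr>)"
    using comm_group_if_iso_image_comm_group[OF \<psi> L.group_G G' L.subgroup_Q] L.not_comm_Q by blast
  moreover have "finite (carrier G')" using D by (simp add: difference_set_iff)
  ultimately show ?thesis using G' D by blast
qed

end
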